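(* Let $r>r_0>0$ be real numbers, let $N>1$ and $d>1$ be integers, and let $P:=\{\mathbf{p}_1,\mathbf{p}_2,\dots,\mathbf{p}_N\}\subset\mathbb{E}^d$ be a set of points whose circumradius is $r_{cr}(P)=r_0$. Then $$V_d(S_{r,r_0,d})\leq V_d\left(\mathrm{conv}_r P\right).$$
   Context: $\mathbb{E}^d$ is $d$-dimensional Euclidean space, $\mathbf{B}^d[\mathbf{x},r]$ is the closed ball of radius $r$ centered at $\mathbf{x}$, and $V_d$ is $d$-dimensional Lebesgue measure (volume). The circumradius $r_{cr}(X)$ of a bounded set $X$ is the radius of the smallest closed ball containing $X$. For $\emptyset\neq K\subset\mathbb{E}^d$ and $r>0$, the $r$-ball convex hull of $K$ is $\mathrm{conv}_rK:=\bigcap\{\mathbf{B}^d[\mathbf{x},r] : K\subseteq\mathbf{B}^d[\mathbf{x},r]\}$. If $K=\{\mathbf{x},\mathbf{y}\}$ with $0<\|\mathbf{x}-\mathbf{y}\|\leq 2r$, then $\mathrm{conv}_rK$ is called an $r$-spindle; its circumradius is $\frac12\|\mathbf{x}-\mathbf{y}\|$. For $r\geq\lambda>0$, $S_{r,\lambda,d}$ denotes an $r$-spindle in $\mathbb{E}^d$ whose circumradius is $\lambda$ (unique up to congruence). *)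

theory Defs
  imports "HOL-Analysis.Analysis"
begin

text \<open>The Euclidean space \<open>E^d\<close> is an arbitrary type of class
  \<^class>\<open>euclidean_space\<close> of dimension \<open>d\<close>.\<close>

text \<open>The minimum below exists for every nonempty bounded \<open>X\<close>. The bound \<open>0 \<le> \<rho>\<close> only
  matters for \<open>X = {}\<close>, since \<^const>\<open>cball\<close> is empty for negative radii.\<close>

definition circumradius :: "'a::euclidean_space set \<Rightarrow> real" where
  "circumradius X = (LEAST \<rho>. 0 \<le> \<rho> \<and> (\<exists>c. X \<subseteq> cball c \<rho>))"

definition ball_hull :: "real \<Rightarrow> 'a::euclidean_space set \<Rightarrow> 'a set" where
  "ball_hull r K = \<Inter>{cball x r |x. K \<subseteq> cball x r}"

definition is_spindle :: "real \<Rightarrow> 'a::euclidean_space set \<Rightarrow> bool" where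
  "is_spindle r S \<longleftrightarrow> (\<exists>x y. 0 < norm (x - y) \<and> norm (x - y) \<le> 2 * r \<and> S = ball_hull r {x, y})"

text \<open>\<open>S\<close> is a copy of the spindle \<open>S_{r,l,d}\<close>, which is determined only up to congruence;
  it is therefore rendered as a predicate.\<close>

definition is_spindle_of_circumradius :: "real \<Rightarrow> real \<Rightarrow> 'a::euclidean_space set \<Rightarrow> bool" where
  "is_spindle_of_circumradius r l S \<longleftrightarrow> is_spindle r S \<and> circumradius S = l"

end

theory Submission imports Defs begin

text \<open>
  Put the centre of the smallest ball containing \<open>P\<close> at the origin, write \<open>l\<close> for its radius and
  \<open>h = sqrt (r\<^sup>2 - l\<^sup>2)\<close>, and let \<open>U\<close> be the set of points of \<open>P\<close> on its boundary. By minimality, every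
  closed half-space bounded by a hyperplane through the origin contains a point of \<open>U\<close>
  (\<open>touching_points_surround\<close>). It follows that a ball of radius \<open>r\<close> that contains \<open>P\<close> has its centre
  within \<open>h\<close> of the origin, and then that it contains, for each \<open>u \<in> U\<close>, the half with tip \<open>u\<close> of
  the spindle spanned by \<open>u\<close> and \<open>-u\<close> (\<open>half_spindles_in_ball_hull\<close>). So the \<open>r\<close>-ball hull contains
  a union of half-spindles, all congruent to half of the spindle \<open>S\<close>. They overlap, and it remains to
  bound the volume of their union from below by the volume of two of them.

  Cut space into the open cells \<open>cell U u\<close> of the points closer to \<open>u\<close> than to every other element
  of \<open>U\<close>. These are disjoint cones around the rays through the \<open>u\<close>, each lies in the half-space
  \<open>0 \<le> y \<bullet> u\<close>, and up to hyperplanes they cover everything (\<open>cells_cover_ball\<close>). Only the part of each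
  half-spindle in its own cell is counted. The central inequality (\<open>cone_share\<close>) says that a cell
  contains at least as large a share of its half-spindle as of the half of the unit ball around the
  same axis. The cells share out the whole unit ball, that is, two half-balls; hence the counted
  parts together have the volume of at least two half-spindles.

  The central inequality holds because both the cell and the half-spindle favour small angles to the
  axis \<open>e\<close>. Write a point as \<open>a e + b \<omega>\<close> with \<open>\<omega>\<close> a unit vector orthogonal to \<open>e\<close>. For fixed \<open>\<omega>\<close> the cell
  becomes a wedge of directions in the quadrant of the pairs \<open>(a, b)\<close>, and the half-spindle becomes a
  region whose polar radius decreases with the angle to the first axis. If \<open>\<gamma>\<close> is the supremum of the
  norms in this region outside the wedge, then inside the wedge the region contains the disc of
  radius \<open>\<gamma>\<close>, and outside the wedge it is contained in this disc. So the wedge takes a larger share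
  of the region than of the disc (\<open>wedge_share\<close>). Finally one averages over \<open>\<omega>\<close>, which Lebesgue measure makes
  independent of \<open>(a, b)\<close> (\<open>cyl_dir_product\<close>).
\<close>

section \<open>Lebesgue measure under linear bijections\<close>

lemma nn_integral_lborel_translate:
  fixes c :: "'a::euclidean_space" and f :: "'a \<Rightarrow> ennreal"
  assumes [measurable]: "f \<in> borel_measurable borel"
  shows "(\<integral>\<^sup>+x. f (c + x) \<partial>lborel) = (\<integral>\<^sup>+x. f x \<partial>lborel)"
proof -
  have "(\<integral>\<^sup>+x. f x \<partial>lborel) = (\<integral>\<^sup>+x. f x \<partial>distr lborel borel ((+) c))"
    by (simp only: lborel_distr_plus)
  also have "\<dots> = (\<integral>\<^sup>+x. f (c + x) \<partial>lborel)"
    by (rule nn_integral_distr) auto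
  finally show ?thesis by simp
qed

lemma borel_measurable_linear:
  fixes T :: "'a::euclidean_space \<Rightarrow> 'a"
  assumes "linear T"
  shows "T \<in> borel_measurable borel"
  using assms linear_conv_bounded_linear linear_continuous_on borel_measurable_continuous_onI by blast

text \<open>
  The preimage measure is translation invariant, so it is a multiple of Lebesgue measure. The unit ball
  fixes the factor without any determinants: for \<open>f\<close> and \<open>g\<close> the indicators of \<open>A\<close> and of the ball, translation
  invariance and Tonelli turn
  \<open>\<integral>\<integral> f (T x) g y\<close> first into \<open>\<integral>\<integral> f (T x + y) g y\<close>, then into \<open>\<integral>\<integral> f y g (y - T x)\<close>,
  and finally into \<open>\<integral>\<integral> f y g (- T x)\<close>.
\<close>
lemma emeasure_linear_vimage_ball:
  fixes T T' :: "'a::euclidean_space \<Rightarrow> 'a"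
  assumes T: "linear T" and TT': "\<And>x. T (T' x) = x" and A [measurable]: "A \<in> sets borel"
  shows "emeasure lborel (T -` A) * emeasure lborel (ball (0::'a) 1)
       = emeasure lborel A * emeasure lborel (T -` ball 0 1)"
proof -
  note [measurable] = borel_measurable_linear[OF T]
  define f g :: "'a \<Rightarrow> ennreal" where "f = indicator A" and "g = indicator (ball 0 1)"
  have [measurable]: "f \<in> borel_measurable borel" "g \<in> borel_measurable borel"
    unfolding f_def g_def by (auto intro!: borel_measurable_indicator)
  have add: "T (x + y) = T x + T y" "T (- x) = - T x" for x y
    using T linear_add linear_neg by blast+
  have "(\<integral>\<^sup>+x. f (T x) \<partial>lborel) * (\<integral>\<^sup>+y. g y \<partial>lborel) = (\<integral>\<^sup>+y. g y * (\<integral>\<^sup>+x. f (T x) \<partial>lborel) \<partial>lborel)"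
    by (simp add: nn_integral_multc mult.commute)
  also have "\<dots> = (\<integral>\<^sup>+y. g y * (\<integral>\<^sup>+x. f (T x + y) \<partial>lborel) \<partial>lborel)"
  proof (rule nn_integral_cong)
    fix y
    have "(\<integral>\<^sup>+x. f (T (T' y + x)) \<partial>lborel) = (\<integral>\<^sup>+x. f (T x) \<partial>lborel)"
      by (rule nn_integral_lborel_translate) measurable
    then show "g y * (\<integral>\<^sup>+x. f (T x) \<partial>lborel) = g y * (\<integral>\<^sup>+x. f (T x + y) \<partial>lborel)"
      by (simp add: add TT' add.commute)
  qed
  also have "\<dots> = (\<integral>\<^sup>+y. (\<integral>\<^sup>+x. g y * f (T x + y) \<partial>lborel) \<partial>lborel)"
    by (simp add: nn_integral_cmult)
  also have "\<dots> = (\<integral>\<^sup>+x. (\<integral>\<^sup>+y. g y * f (T x + y) \<partial>lborel) \<partial>lborel)"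
    by (rule lborel_pair.Fubini') measurable
  also have "\<dots> = (\<integral>\<^sup>+x. (\<integral>\<^sup>+y. f y * g (y - T x) \<partial>lborel) \<partial>lborel)"
  proof (rule nn_integral_cong)
    fix x
    have "(\<integral>\<^sup>+y. f (T x + y) * g (T x + y - T x) \<partial>lborel) = (\<integral>\<^sup>+y. f y * g (y - T x) \<partial>lborel)"
      by (rule nn_integral_lborel_translate) measurable
    then show "(\<integral>\<^sup>+y. g y * f (T x + y) \<partial>lborel) = (\<integral>\<^sup>+y. f y * g (y - T x) \<partial>lborel)"
      by (simp add: mult.commute)
  qed
  also have "\<dots> = (\<integral>\<^sup>+y. (\<integral>\<^sup>+x. f y * g (y - T x) \<partial>lborel) \<partial>lborel)"
    by (rule lborel_pair.Fubini') measurable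
  also have "\<dots> = (\<integral>\<^sup>+y. f y * (\<integral>\<^sup>+x. g (y - T x) \<partial>lborel) \<partial>lborel)"
    by (simp add: nn_integral_cmult)
  also have "\<dots> = (\<integral>\<^sup>+y. f y * (\<integral>\<^sup>+x. g (- T x) \<partial>lborel) \<partial>lborel)"
  proof (rule nn_integral_cong)
    fix y
    have "(\<integral>\<^sup>+x. g (y - T (T' y + x)) \<partial>lborel) = (\<integral>\<^sup>+x. g (y - T x) \<partial>lborel)"
      by (rule nn_integral_lborel_translate) measurable
    then show "f y * (\<integral>\<^sup>+x. g (y - T x) \<partial>lborel) = f y * (\<integral>\<^sup>+x. g (- T x) \<partial>lborel)"
      by (simp add: add TT')
  qed
  also have "\<dots> = (\<integral>\<^sup>+y. f y \<partial>lborel) * (\<integral>\<^sup>+x. g (- T x) \<partial>lborel)"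
    by (simp add: nn_integral_multc)
  finally have *: "(\<integral>\<^sup>+x. f (T x) \<partial>lborel) * (\<integral>\<^sup>+y. g y \<partial>lborel) = (\<integral>\<^sup>+y. f y \<partial>lborel) * (\<integral>\<^sup>+x. g (- T x) \<partial>lborel)" .
  have "f (T x) = indicator (T -` A) x" "g (- T x) = indicator (T -` ball 0 1) x" for x
    by (auto simp: f_def g_def indicator_def)
  moreover have "T -` A \<in> sets borel" "T -` ball 0 1 \<in> sets borel"
    using measurable_sets[OF borel_measurable_linear[OF T], of A] 
      measurable_sets[OF borel_measurable_linear[OF T], of "ball 0 1"] by auto
  ultimately show ?thesis
    using * by (simp add: f_def[symmetric] g_def[symmetric]) (simp add: f_def g_def)
qed

lemma emeasure_unit_ball: "emeasure lborel (ball (0::'a::euclidean_space) 1) \<noteq> 0"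
  "emeasure lborel (ball (0::'a::euclidean_space) 1) \<noteq> \<infinity>"
  by (simp_all add: emeasure_ball less_imp_neq[OF unit_ball_vol_pos, symmetric])

lemma emeasure_linear_vimage:
  fixes T T' :: "'a::euclidean_space \<Rightarrow> 'a"
  assumes T: "linear T" and TT': "\<And>x. T (T' x) = x"
  obtains k where "\<And>A. A \<in> sets borel \<Longrightarrow> emeasure lborel (T -` A) = k * emeasure lborel A"
proof
  let ?b = "emeasure lborel (ball (0::'a) 1)"
  fix A :: "'a set" assume "A \<in> sets borel"
  have "emeasure lborel (T -` A) = emeasure lborel (T -` A) * ?b / ?b"
    using emeasure_unit_ball[where 'a='a] by (simp add: ennreal_mult_divide_eq)
  also have "\<dots> = emeasure lborel (T -` ball 0 1) / ?b * emeasure lborel A"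
    unfolding emeasure_linear_vimage_ball[OF T TT' \<open>A \<in> sets borel\<close>]
    by (simp add: ennreal_times_divide mult.commute)
  finally show "emeasure lborel (T -` A) = emeasure lborel (T -` ball 0 1) / ?b * emeasure lborel A" .
qed

lemma emeasure_isometry_vimage:
  fixes T T' :: "'a::euclidean_space \<Rightarrow> 'a"
  assumes T: "linear T" and TT': "\<And>x. T (T' x) = x" and n: "\<And>x. norm (T x) = norm x"
    and A: "A \<in> sets borel"
  shows "emeasure lborel (T -` A) = emeasure lborel A"
proof -
  have "T -` ball 0 1 = ball 0 1" using n by auto
  then show ?thesis
    using emeasure_linear_vimage_ball[OF T TT' A] emeasure_unit_ball[where 'a='a]
    by (metis ennreal_mult_cancel_left infinity_ennreal_def mult.commute)
qed

section \<open>Cylindrical coordinates around an axis\<close>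

definition perp :: "'a::euclidean_space \<Rightarrow> 'a \<Rightarrow> 'a" where
  "perp e y = y - (y \<bullet> e) *\<^sub>R e"

definition cyl :: "'a::euclidean_space \<Rightarrow> 'a \<Rightarrow> real \<times> real" where
  "cyl e y = (y \<bullet> e, norm (perp e y))"

text \<open>Multiplication by \<open>a\<close> along the axis and by \<open>b\<close> orthogonally to it, for a unit vector \<open>e\<close>.\<close>
definition stretch :: "'a::euclidean_space \<Rightarrow> real \<Rightarrow> real \<Rightarrow> 'a \<Rightarrow> 'a" where
  "stretch e a b y = b *\<^sub>R y + ((a - b) * (y \<bullet> e)) *\<^sub>R e"

definition quadrant :: "(real \<times> real) set" where
  "quadrant = {z. 0 < fst z \<and> 0 \<le> snd z}"

lemma linear_perp: "linear (perp e)"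
  unfolding perp_def by (rule linearI) (auto simp: inner_simps algebra_simps)

lemma perp_scaleR [simp]: "perp e (c *\<^sub>R y) = c *\<^sub>R perp e y"
  using linear_perp linear_scale by blast

lemma measurable_perp [measurable]: "perp e \<in> borel_measurable borel"
  by (intro borel_measurable_linear linear_perp)

lemma measurable_cyl [measurable]: "cyl e \<in> borel_measurable borel"
  unfolding cyl_def by measurable

lemma axis_perp_decomposition: "y = (y \<bullet> e) *\<^sub>R e + norm (perp e y) *\<^sub>R sgn (perp e y)"
proof -
  have "norm w *\<^sub>R sgn w = w" for w :: 'a
    by (cases "w = 0") (simp_all add: sgn_div_norm)
  then show ?thesis by (simp add: perp_def)
qed

lemma cyl_scaleR: "0 < c \<Longrightarrow> cyl e (c *\<^sub>R y) = c *\<^sub>R cyl e y"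
  by (simp add: cyl_def)

context
  fixes e :: "'a::euclidean_space"
  assumes unit: "norm e = 1"
begin

lemma inner_self: "e \<bullet> e = 1" using unit by (simp add: norm_eq_1)

lemma norm_cyl: "norm (cyl e y) = norm y"
proof -
  have "(norm (perp e y))\<^sup>2 = (norm y)\<^sup>2 - (y \<bullet> e)\<^sup>2"
    by (simp add: perp_def power2_norm_eq_inner inner_simps inner_self inner_commute) 
       (simp add: power2_eq_square)
  then show ?thesis by (simp add: cyl_def norm_Pair)
qed

lemma linear_stretch: "linear (stretch e a b)"
  unfolding stretch_def by (rule linearI) (auto simp: inner_simps algebra_simps)

lemma stretch_inner: "stretch e a b y \<bullet> e = a * (y \<bullet> e)"
  by (simp add: stretch_def inner_simps inner_self algebra_simps)

lemma perp_stretch: "perp e (stretch e a b y) = b *\<^sub>R perp e y"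
  unfolding perp_def stretch_inner by (simp add: stretch_def algebra_simps)

lemma stretch_stretch: "a \<noteq> 0 \<Longrightarrow> b \<noteq> 0 \<Longrightarrow> stretch e (1/a) (1/b) (stretch e a b y) = y"
  by (subst (1) stretch_def) (simp add: stretch_inner, simp add: stretch_def field_simps scaleR_left_distrib[symmetric] scaleR_right_distrib)

end

section \<open>Independence of the direction from the cylindrical position\<close>

definition cylinder :: "'a::euclidean_space \<Rightarrow> real \<Rightarrow> real \<Rightarrow> 'a set" where
  "cylinder e a b = {y. 0 < y \<bullet> e \<and> y \<bullet> e \<le> a \<and> norm (perp e y) \<le> b}"

lemma cylinder_borel [measurable]: "cylinder e a b \<in> sets borel"
  unfolding cylinder_def by measurable

lemma negligible_iff_emeasure_lborel:
  assumes "A \<in> sets borel"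
  shows "negligible A \<longleftrightarrow> emeasure lborel A = 0"
  using assms by (simp add: negligible_iff_emeasure0 sets_completionI_sets main_part_sets emeasure_completion)

lemma emeasure_axis:
  fixes e :: "'a::euclidean_space"
  assumes "2 \<le> DIM('a)"
  shows "emeasure lborel {y. perp e y = 0} = 0"
proof -
  obtain f where f: "f \<noteq> 0" "orthogonal e f"
    using orthogonal_to_vector_exists[OF assms] by metis
  have "{y. perp e y = 0} \<subseteq> {y. f \<bullet> y = 0}"
  proof safe
    fix y assume "perp e y = 0"
    then have "y = (y \<bullet> e) *\<^sub>R e" by (simp add: perp_def)
    then have "f \<bullet> y = (y \<bullet> e) * (f \<bullet> e)" by (metis inner_scaleR_right)
    then show "f \<bullet> y = 0" using f(2) by (simp add: orthogonal_def inner_commute)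
  qed
  then have "negligible {y. perp e y = 0}"
    using f(1) negligible_hyperplane negligible_subset by blast
  moreover have "{y. perp e y = 0} \<in> sets borel" by measurable
  ultimately show ?thesis using negligible_iff_emeasure_lborel by blast
qed

context
  fixes e :: "'a::euclidean_space"
  assumes unit: "norm e = 1" and dim: "2 \<le> DIM('a)"
begin

lemma cylinder_finite: "emeasure lborel (cylinder e a b) < \<infinity>"
proof -
  have "cylinder e a b \<subseteq> cball 0 (\<bar>a\<bar> + \<bar>b\<bar>)"
  proof
    fix y assume y: "y \<in> cylinder e a b"
    have "norm y \<le> norm ((y \<bullet> e) *\<^sub>R e) + norm (perp e y)"
      unfolding perp_def by (metis add_diff_cancel_left' add.commute diff_add_cancel norm_triangle_ineq)
    then show "y \<in> cball 0 (\<bar>a\<bar> + \<bar>b\<bar>)" using y unit by (auto simp: cylinder_def)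
  qed
  then have "emeasure lborel (cylinder e a b) \<le> emeasure lborel (cball (0::'a) (\<bar>a\<bar> + \<bar>b\<bar>))"
    by (intro emeasure_mono) auto
  then show ?thesis using emeasure_lborel_cball_finite le_less_trans by blast
qed

lemma cylinder_nonzero: "emeasure lborel (cylinder e 1 1) \<noteq> 0"
proof -
  let ?U = "{y. 0 < y \<bullet> e \<and> y \<bullet> e < 1 \<and> norm (perp e y) < 1}"
  have "open ?U"
    unfolding perp_def by (intro open_Collect_conj open_Collect_less continuous_intros)
  moreover have "(1/2) *\<^sub>R e \<in> ?U"
    by (simp add: perp_def inner_self[OF unit])
  ultimately have "emeasure lborel ?U \<noteq> 0"
    using open_not_negligible[of ?U] negligible_iff_emeasure_lborel[of ?U] borel_open[of ?U] by blast
  moreover have "emeasure lborel ?U \<le> emeasure lborel (cylinder e 1 1)"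
    by (intro emeasure_mono) (auto simp: cylinder_def)
  ultimately show ?thesis by auto
qed

text \<open>
  A stretching of the axis and of its orthogonal complement carries the unit cylinder to any other one
  and leaves the direction \<open>sgn (perp e y)\<close> alone. Therefore the factor \<open>k\<close> is the same for
  all sets \<open>W\<close> of directions, and this is the source of the independence.
\<close>
lemma emeasure_cylinder_sector:
  assumes "0 < a" "0 < b"
  obtains k where "\<And>W. W \<in> sets borel \<Longrightarrow>
    emeasure lborel (cylinder e a b \<inter> (\<lambda>y. sgn (perp e y)) -` W)
    = k * emeasure lborel (cylinder e 1 1 \<inter> (\<lambda>y. sgn (perp e y)) -` W)"
proof -
  let ?T = "stretch e (1/a) (1/b)"
  have "?T (stretch e a b y) = y" for y
    using stretch_stretch[OF unit] assms by simp
  then obtain k where k: "\<And>A. A \<in> sets borel \<Longrightarrow> emeasure lborel (?T -` A) = k * emeasure lborel A"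
    using emeasure_linear_vimage[OF linear_stretch[OF unit], of "1/a" "1/b" "stretch e a b"] by metis
  have "?T -` (cylinder e 1 1 \<inter> (\<lambda>y. sgn (perp e y)) -` W) 
     = cylinder e a b \<inter> (\<lambda>y. sgn (perp e y)) -` W" for W
    using assms by (auto simp: cylinder_def stretch_inner[OF unit] perp_stretch[OF unit] sgn_scaleR field_simps)
  moreover have "cylinder e 1 1 \<inter> (\<lambda>y. sgn (perp e y)) -` W \<in> sets borel" if "W \<in> sets borel" for W
    using that by measurable
  ultimately show thesis using k that by metis
qed

text \<open>
  For fixed \<open>W\<close> both sides are measures in \<open>E\<close>, so it suffices to compare them on the sets
  \<open>{..(a, b)}\<close>, whose preimages are cylinders.
\<close>
lemma cyl_sgn_independent:
  assumes E [measurable]: "E \<in> sets borel" and W [measurable]: "W \<in> sets borel"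
  shows "emeasure lborel {y. 0 < y \<bullet> e \<and> cyl e y \<in> E \<and> sgn (perp e y) \<in> W} * emeasure lborel (cylinder e 1 1)
   = emeasure lborel {y. 0 < y \<bullet> e \<and> cyl e y \<in> E} * emeasure lborel (cylinder e 1 1 \<inter> (\<lambda>y. sgn (perp e y)) -` W)"
proof -
  let ?q = "emeasure lborel (cylinder e 1 1)"
  let ?c = "emeasure lborel (cylinder e 1 1 \<inter> (\<lambda>y. sgn (perp e y)) -` W)"
  let ?S = "{y. 0 < y \<bullet> e \<and> sgn (perp e y) \<in> W}"
  define M where "M S = distr (density lborel (indicator S)) borel (cyl e)" for S
  have M: "emeasure (M S) X = emeasure lborel (S \<inter> cyl e -` X)" 
    if [measurable]: "S \<in> sets borel" "X \<in> sets borel" for S X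
  proof -
    have "cyl e -` X \<in> sets borel" using measurable_sets[OF measurable_cyl that(2)] by simp
    then show ?thesis
      unfolding M_def by (simp add: emeasure_distr emeasure_restricted that)
  qed
  have [measurable]: "?S \<in> sets borel" by measurable
  have [measurable]: "{y. 0 < y \<bullet> e} \<in> sets borel" by measurable
  have "scale_measure ?q (M ?S) = scale_measure ?c (M {y. 0 < y \<bullet> e})"
  proof (rule measure_eqI_generator_eq[where E = "range (\<lambda>z. {..z})" and \<Omega> = UNIV and A = "\<lambda>n. {..(real n, real n)}"])
    show "Int_stable (range (\<lambda>z::real\<times>real. {..z}))"
    proof (clarsimp simp: Int_stable_def)
      fix a b a' b' :: real
      have "{..(a, b)} \<inter> {..(a', b')} = {..(min a a', min b b')}" by auto
      then show "{..(a, b)} \<inter> {..(a', b')} \<in> range (\<lambda>z. {..z})" by blast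
    qed
    show "range (\<lambda>z::real\<times>real. {..z}) \<subseteq> Pow UNIV" by simp
    have "sets (borel :: (real \<times> real) measure) = sigma_sets UNIV (range (\<lambda>z. {..z}))"
      by (subst borel_eq_atMost) simp
    then show "sets (scale_measure ?q (M ?S)) = sigma_sets UNIV (range (\<lambda>z. {..z}))"
       "sets (scale_measure ?c (M {y. 0 < y \<bullet> e})) = sigma_sets UNIV (range (\<lambda>z. {..z}))"
      by (simp_all add: M_def)
    show "(\<Union>n. {..(real n, real n)}) = UNIV"
    proof safe
      fix a b :: real
      obtain n where "max a b \<le> real n" using real_arch_simple by blast
      then show "(a, b) \<in> (\<Union>n. {..(real n, real n)})" by auto
    qed auto
    show "range (\<lambda>n. {..(real n, real n)}) \<subseteq> range (\<lambda>z. {..z})" by auto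
    have vim: "S \<inter> cyl e -` {..(a,b)} \<subseteq> cylinder e a b" if "S \<subseteq> {y. 0 < y \<bullet> e}" for S a b
      using that by (auto simp: cylinder_def cyl_def)
    show "emeasure (scale_measure ?q (M ?S)) {..(real n, real n)} \<noteq> \<infinity>" for n
    proof -
      have "emeasure (M ?S) {..(real n, real n)} \<le> emeasure lborel (cylinder e n n)"
        by (subst M) (auto intro!: emeasure_mono vim)
      also have "\<dots> < \<infinity>" by (rule cylinder_finite)
      finally show ?thesis using cylinder_finite[of 1 1]
        by (auto simp: ennreal_mult_eq_top_iff less_top)
    qed
    fix X :: "(real \<times> real) set" assume "X \<in> range (\<lambda>z. {..z})"
    then obtain a b where X: "X = {..(a,b)}" by auto
    have eqs: "?S \<inter> cyl e -` X = cylinder e a b \<inter> (\<lambda>y. sgn (perp e y)) -` W"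
      "{y. 0 < y \<bullet> e} \<inter> cyl e -` X = cylinder e a b \<inter> (\<lambda>y. sgn (perp e y)) -` UNIV"
      by (auto simp: X cylinder_def cyl_def)
    have "X \<in> sets borel" by (simp add: X)
    consider "0 < a" "0 < b" | "a \<le> 0 \<or> b \<le> 0" by linarith
    then show "emeasure (scale_measure ?q (M ?S)) X = emeasure (scale_measure ?c (M {y. 0 < y \<bullet> e})) X"
    proof cases
      case 1
      then obtain k where k: "\<And>W. W \<in> sets borel \<Longrightarrow>
        emeasure lborel (cylinder e a b \<inter> (\<lambda>y. sgn (perp e y)) -` W)
        = k * emeasure lborel (cylinder e 1 1 \<inter> (\<lambda>y. sgn (perp e y)) -` W)"
        using emeasure_cylinder_sector by metis
      show ?thesis
        using \<open>X \<in> sets borel\<close> k[OF W] k[of UNIV] by (simp add: M eqs mult_ac)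
    next
      case 2
      \<comment> \<open>A degenerate cylinder lies on the axis, a null set in dimension at least two.\<close>
      have "perp e y = 0" if "y \<in> cylinder e a b" for y
      proof -
        have "0 < y \<bullet> e" "y \<bullet> e \<le> a" "norm (perp e y) \<le> b"
          using that by (simp_all add: cylinder_def)
        with 2 have "norm (perp e y) \<le> 0" by linarith
        then show ?thesis by simp
      qed
      then have "emeasure lborel (cylinder e a b) \<le> emeasure lborel {y. perp e y = 0}"
        by (intro emeasure_mono) auto
      then have z: "emeasure lborel (cylinder e a b) = 0" using emeasure_axis[OF dim, of e] by simp
      then have "emeasure lborel (cylinder e a b \<inter> (\<lambda>y. sgn (perp e y)) -` W) = 0"
        using emeasure_mono[of "cylinder e a b \<inter> (\<lambda>y. sgn (perp e y)) -` W" "cylinder e a b" lborel] by simp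
      then show ?thesis using \<open>X \<in> sets borel\<close> z by (simp add: M eqs)
    qed
  qed
  then have "emeasure (scale_measure ?q (M ?S)) E = emeasure (scale_measure ?c (M {y. 0 < y \<bullet> e})) E"
    by simp
  moreover have "?S \<inter> cyl e -` E = {y. 0 < y \<bullet> e \<and> cyl e y \<in> E \<and> sgn (perp e y) \<in> W}"
    "{y. 0 < y \<bullet> e} \<inter> cyl e -` E = {y. 0 < y \<bullet> e \<and> cyl e y \<in> E}"
    by auto
  ultimately show ?thesis by (simp add: M mult.commute)
qed

end

text \<open>
  On the half-space \<open>0 < y \<bullet> e\<close>, Lebesgue measure will be the product of the next two measures:
  the distribution of the cylindrical position and the probability distribution of the direction.
\<close>
definition cyl_measure :: "'a::euclidean_space \<Rightarrow> (real \<times> real) measure" where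
  "cyl_measure e = distr (density lborel (indicator {y. 0 < y \<bullet> e})) borel (cyl e)"

definition dir_measure :: "'a::euclidean_space \<Rightarrow> 'a measure" where
  "dir_measure e = scale_measure (1 / emeasure lborel (cylinder e 1 1))
     (distr (density lborel (indicator (cylinder e 1 1))) borel (\<lambda>y. sgn (perp e y)))"

lemma sets_cyl_measure [simp, measurable_cong]: "sets (cyl_measure e) = sets borel"
  and space_cyl_measure [simp]: "space (cyl_measure e) = UNIV"
  by (simp_all add: cyl_measure_def)

lemma sets_dir_measure [simp, measurable_cong]: "sets (dir_measure e) = sets borel"
  and space_dir_measure [simp]: "space (dir_measure e) = UNIV"
  by (simp_all add: dir_measure_def space_scale_measure)

lemma emeasure_cyl_measure:
  assumes [measurable]: "E \<in> sets borel"
  shows "emeasure (cyl_measure e) E = emeasure lborel {y. 0 < y \<bullet> e \<and> cyl e y \<in> E}"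
proof -
  have "cyl e -` E \<in> sets borel" using measurable_sets[OF measurable_cyl assms] by simp
  moreover have "{y. 0 < y \<bullet> e} \<inter> cyl e -` E = {y. 0 < y \<bullet> e \<and> cyl e y \<in> E}" by auto
  ultimately show ?thesis
    unfolding cyl_measure_def by (simp add: emeasure_distr emeasure_restricted)
qed

lemma emeasure_dir_measure:
  assumes [measurable]: "W \<in> sets borel"
  shows "emeasure (dir_measure e) W = emeasure lborel (cylinder e 1 1 \<inter> (\<lambda>y. sgn (perp e y)) -` W)
      / emeasure lborel (cylinder e 1 1)"
proof -
  have "(\<lambda>y. sgn (perp e y)) -` W \<in> sets borel"
    using measurable_sets[of "\<lambda>y. sgn (perp e y)" borel borel W] by simp
  then show ?thesis
    unfolding dir_measure_def
    by (simp add: emeasure_distr emeasure_restricted divide_ennreal_def mult.commute)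
qed

context
  fixes e :: "'a::euclidean_space"
  assumes unit: "norm e = 1" and dim: "2 \<le> DIM('a)"
begin

lemma dir_measure_UNIV: "emeasure (dir_measure e) UNIV = 1"
  using cylinder_nonzero[OF unit dim] cylinder_finite[OF unit dim, of 1 1]
  by (simp add: emeasure_dir_measure)

lemma sigma_finite_cyl_measure: "sigma_finite_measure (cyl_measure e)"
proof
  have "\<Union> (range (\<lambda>n::nat. cball 0 (real n))) = (UNIV :: (real \<times> real) set)"
    by (auto simp: real_arch_simple)
  moreover have "emeasure (cyl_measure e) (cball 0 (real n)) \<noteq> \<infinity>" for n
  proof -
    have "emeasure (cyl_measure e) (cball 0 (real n)) \<le> emeasure lborel (cball (0::'a) n)"
      using norm_cyl[OF unit] by (subst emeasure_cyl_measure) (auto intro!: emeasure_mono)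
    then show ?thesis using emeasure_lborel_cball_finite[of "0::'a" n] by auto
  qed
  ultimately show "\<exists>A. countable A \<and> A \<subseteq> sets (cyl_measure e) \<and>
    \<Union> A = space (cyl_measure e) \<and> (\<forall>a\<in>A. emeasure (cyl_measure e) a \<noteq> \<infinity>)"
    by (intro exI[of _ "range (\<lambda>n::nat. cball 0 (real n))"]) auto
qed

lemma finite_dir_measure: "finite_measure (dir_measure e)"
  using dir_measure_UNIV by (intro finite_measureI) simp

lemma cyl_dir_product:
  "cyl_measure e \<Otimes>\<^sub>M dir_measure e =
   distr (density lborel (indicator {y. 0 < y \<bullet> e})) (borel \<Otimes>\<^sub>M borel) (\<lambda>y. (cyl e y, sgn (perp e y)))"
proof (rule pair_measure_eqI)
  show "sigma_finite_measure (cyl_measure e)" by (rule sigma_finite_cyl_measure)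
  show "sigma_finite_measure (dir_measure e)"
    using finite_dir_measure by (simp add: finite_measure.axioms(1))
  show "sets (cyl_measure e \<Otimes>\<^sub>M dir_measure e) = sets (distr (density lborel (indicator {y. 0 < y \<bullet> e}))
     (borel \<Otimes>\<^sub>M borel) (\<lambda>y. (cyl e y, sgn (perp e y))))"
    by (simp cong: sets_pair_measure_cong)
  fix E :: "(real \<times> real) set" and W :: "'a set"
  assume "E \<in> sets (cyl_measure e)" "W \<in> sets (dir_measure e)"
  then have [measurable]: "E \<in> sets borel" "W \<in> sets borel" by simp_all
  let ?q = "emeasure lborel (cylinder e 1 1)"
  let ?F = "{y. 0 < y \<bullet> e \<and> cyl e y \<in> E \<and> sgn (perp e y) \<in> W}"
  have [measurable]: "{y. 0 < y \<bullet> e} \<in> sets borel" by measurable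
  have pre: "(\<lambda>y. (cyl e y, sgn (perp e y))) -` (E \<times> W) \<in> sets borel"
    using measurable_sets[of "\<lambda>y. (cyl e y, sgn (perp e y))" borel "borel \<Otimes>\<^sub>M borel" "E \<times> W"] by simp
  have "emeasure (cyl_measure e) E * emeasure (dir_measure e) W = emeasure lborel ?F * ?q / ?q"
    using cyl_sgn_independent[OF unit dim, of E W]
    by (simp add: emeasure_cyl_measure emeasure_dir_measure ennreal_times_divide)
  also have "\<dots> = emeasure lborel ?F"
    using cylinder_nonzero[OF unit dim] cylinder_finite[OF unit dim, of 1 1]
    by (simp add: ennreal_mult_divide_eq)
  also have "?F = {y. 0 < y \<bullet> e} \<inter> (\<lambda>y. (cyl e y, sgn (perp e y))) -` (E \<times> W)" by auto
  finally show "emeasure (cyl_measure e) E * emeasure (dir_measure e) W =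
    emeasure (distr (density lborel (indicator {y. 0 < y \<bullet> e})) (borel \<Otimes>\<^sub>M borel) (\<lambda>y. (cyl e y, sgn (perp e y)))) (E \<times> W)"
    using pre by (simp add: emeasure_distr emeasure_restricted)
qed

text \<open>
  Tonelli's theorem in the product coordinates: the volume is the average over all directions \<open>\<omega>\<close> of the
  planar slices through the axis.
\<close>
lemma emeasure_as_direction_average:
  assumes A [measurable]: "A \<in> sets borel" and V [measurable]: "V \<in> sets borel"
  shows "(\<lambda>\<omega>. emeasure (cyl_measure e) {z \<in> A. fst z *\<^sub>R e + snd z *\<^sub>R \<omega> \<in> V}) \<in> borel_measurable (dir_measure e)"
    and "emeasure lborel {y \<in> V. 0 < y \<bullet> e \<and> cyl e y \<in> A} =
     (\<integral>\<^sup>+\<omega>. emeasure (cyl_measure e) {z \<in> A. fst z *\<^sub>R e + snd z *\<^sub>R \<omega> \<in> V} \<partial>dir_measure e)"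
proof -
  interpret D: finite_measure "dir_measure e" by (rule finite_dir_measure)
  interpret C: sigma_finite_measure "cyl_measure e" by (rule sigma_finite_cyl_measure)
  interpret pair_sigma_finite "cyl_measure e" "dir_measure e" ..
  let ?S = "{p :: (real \<times> real) \<times> 'a. fst p \<in> A \<and> fst (fst p) *\<^sub>R e + snd (fst p) *\<^sub>R snd p \<in> V}"
  let ?\<Phi> = "\<lambda>y. (cyl e y, sgn (perp e y))"
  have S [measurable]: "?S \<in> sets (borel \<Otimes>\<^sub>M borel)"
  proof -
    have [measurable]: "fst \<in> borel_measurable (borel :: (real \<times> real) measure)"
      "snd \<in> borel_measurable (borel :: (real \<times> real) measure)"
      by (auto intro!: borel_measurable_continuous_onI continuous_intros)
    have "Measurable.pred (borel \<Otimes>\<^sub>M borel) (\<lambda>p :: (real \<times> real) \<times> 'a. fst p \<in> A \<and> fst (fst p) *\<^sub>R e + snd (fst p) *\<^sub>R snd p \<in> V)"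
      by measurable
    then show ?thesis by (simp add: pred_def space_pair_measure)
  qed
  then have S': "?S \<in> sets (cyl_measure e \<Otimes>\<^sub>M dir_measure e)"
    by (simp cong: sets_pair_measure_cong)
  have sl: "(\<lambda>z. (z, \<omega>)) -` ?S = {z \<in> A. fst z *\<^sub>R e + snd z *\<^sub>R \<omega> \<in> V}" for \<omega> by auto
  show "(\<lambda>\<omega>. emeasure (cyl_measure e) {z \<in> A. fst z *\<^sub>R e + snd z *\<^sub>R \<omega> \<in> V}) \<in> borel_measurable (dir_measure e)"
    using measurable_emeasure_Pair2[OF S'] by (simp add: sl)
  have [measurable]: "{y. 0 < y \<bullet> e} \<in> sets borel" by measurable
  have pre: "?\<Phi> -` ?S \<in> sets borel"
    using measurable_sets[of ?\<Phi> borel "borel \<Otimes>\<^sub>M borel" ?S] by simp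
  have "{y \<in> V. 0 < y \<bullet> e \<and> cyl e y \<in> A} = {y. 0 < y \<bullet> e} \<inter> ?\<Phi> -` ?S"
    using axis_perp_decomposition[of _ e, symmetric] by (auto simp: cyl_def)
  then have "emeasure lborel {y \<in> V. 0 < y \<bullet> e \<and> cyl e y \<in> A} = emeasure (cyl_measure e \<Otimes>\<^sub>M dir_measure e) ?S"
    using pre by (simp add: cyl_dir_product emeasure_distr emeasure_restricted)
  also have "\<dots> = (\<integral>\<^sup>+\<omega>. emeasure (cyl_measure e) {z \<in> A. fst z *\<^sub>R e + snd z *\<^sub>R \<omega> \<in> V} \<partial>dir_measure e)"
    by (subst emeasure_pair_measure_alt2[OF S']) (simp only: sl)
  finally show "emeasure lborel {y \<in> V. 0 < y \<bullet> e \<and> cyl e y \<in> A} =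
     (\<integral>\<^sup>+\<omega>. emeasure (cyl_measure e) {z \<in> A. fst z *\<^sub>R e + snd z *\<^sub>R \<omega> \<in> V} \<partial>dir_measure e)" .
qed

lemma cyl_measure_scale:
  assumes "0 < c"
  obtains k where "\<And>E. E \<in> sets borel \<Longrightarrow> emeasure (cyl_measure e) {z. c *\<^sub>R z \<in> E} = k * emeasure (cyl_measure e) E"
proof -
  obtain k where k: "\<And>A. A \<in> sets borel \<Longrightarrow> emeasure lborel ((\<lambda>y::'a. c *\<^sub>R y) -` A) = k * emeasure lborel A"
    using emeasure_linear_vimage[of "\<lambda>y::'a. c *\<^sub>R y" "\<lambda>y. (1/c) *\<^sub>R y"] assms
    by (metis linear_scale_self mult.commute nonzero_eq_divide_eq less_irrefl scaleR_one scaleR_scaleR)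
  show thesis
  proof
    fix E :: "(real \<times> real) set" assume [measurable]: "E \<in> sets borel"
    have 1: "{z. c *\<^sub>R z \<in> E} \<in> sets borel" by measurable
    have 2: "(\<lambda>y::'a. c *\<^sub>R y) -` {y. 0 < y \<bullet> e \<and> cyl e y \<in> E} = {y. 0 < y \<bullet> e \<and> cyl e y \<in> {z. c *\<^sub>R z \<in> E}}"
      using assms by (auto simp: cyl_scaleR zero_less_mult_iff)
    have 3: "{y. 0 < y \<bullet> e \<and> cyl e y \<in> E} \<in> sets borel" by measurable
    show "emeasure (cyl_measure e) {z. c *\<^sub>R z \<in> E} = k * emeasure (cyl_measure e) E"
      unfolding emeasure_cyl_measure[OF 1] emeasure_cyl_measure[OF \<open>E \<in> sets borel\<close>] k[OF 3, symmetric] 2 ..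
  qed
qed

end

section \<open>A cone around the axis prefers regions concentrated near the axis\<close>

text \<open>
  The regions in the quadrant that are described in polar coordinates by a bounded radius that does not
  increase with the angle to the first axis. The comparison
  \<open>snd z' * fst z \<le> snd z * fst z'\<close> expresses that the angle of \<open>z'\<close> is at most that of \<open>z\<close>.
  The last conjunct closes the region along each ray, so that it contains the endpoint at the
  polar radius.
\<close>
definition polar_decreasing :: "(real \<times> real) set \<Rightarrow> bool" where
  "polar_decreasing A \<longleftrightarrow> A \<subseteq> quadrant \<and> bounded A \<and>
     (\<forall>z\<in>A. \<forall>z'\<in>quadrant. norm z' \<le> norm z \<longrightarrow> snd z' * fst z \<le> snd z * fst z' \<longrightarrow> z' \<in> A) \<and>
     (\<forall>z\<in>quadrant. (\<forall>q. 0 < q \<longrightarrow> q < 1 \<longrightarrow> q *\<^sub>R z \<in> A) \<longrightarrow> z \<in> A)"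

lemma quadrant_borel [measurable]: "quadrant \<in> sets borel"
proof -
  have "quadrant = {z::real\<times>real. 0 < fst z} \<inter> {z. 0 \<le> snd z}" by (auto simp: quadrant_def)
  moreover have "open {z::real\<times>real. 0 < fst z}" "closed {z::real\<times>real. 0 \<le> snd z}"
    by (intro open_Collect_less closed_Collect_le continuous_intros)+
  ultimately show ?thesis by (metis borel_open borel_closed sets.Int)
qed

lemma quadrant_scaleR: "0 < c \<Longrightarrow> c *\<^sub>R z \<in> quadrant \<longleftrightarrow> z \<in> quadrant"
  by (simp add: quadrant_def zero_less_mult_iff zero_le_mult_iff)

context
  fixes e :: "'a::euclidean_space"
  assumes unit: "norm e = 1" and dim: "2 \<le> DIM('a)"
begin

text \<open>
  The disc of radius \<open>\<gamma>\<close>, the supremum of the norms in \<open>A - U\<close>, separates the two parts of \<open>A\<close>: a point of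
  the wedge \<open>U\<close> inside this disc has a smaller angle than some longer point of \<open>A - U\<close>,
  so it belongs to \<open>A\<close>, while all of \<open>A - U\<close> lies in the disc. Since scaling multiplies the measure by a
  constant \<open>k\<close>, the disc of radius \<open>\<gamma>\<close> can be replaced by the unit disc on both sides of the comparison.
\<close>
lemma wedge_share:
  assumes A [measurable]: "A \<in> sets borel" and rA: "polar_decreasing A" and U [measurable]: "U \<in> sets borel"
    and wedge: "\<And>z z'. z \<in> U \<Longrightarrow> z \<in> quadrant \<Longrightarrow> z' \<in> quadrant \<Longrightarrow> snd z' * fst z \<le> snd z * fst z' \<Longrightarrow> z' \<in> U"
  shows "emeasure (cyl_measure e) ((quadrant \<inter> cball 0 1) \<inter> U) * emeasure (cyl_measure e) A
       \<le> emeasure (cyl_measure e) (A \<inter> U) * emeasure (cyl_measure e) (quadrant \<inter> cball 0 1)"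
proof -
  let ?B = "quadrant \<inter> cball (0 :: real \<times> real) 1"
  let ?m = "emeasure (cyl_measure e)"
  have Aq: "A \<subseteq> quadrant" using rA by (simp add: polar_decreasing_def)
  show ?thesis
  proof (cases "A \<subseteq> U")
    case True
    have "?m (?B \<inter> U) \<le> ?m ?B" by (intro emeasure_mono) auto
    with True show ?thesis by (metis Int_absorb2 mult.commute mult_right_mono zero_le)
  next
    case False
    define \<gamma> where "\<gamma> = Sup (norm ` (A - U))"
    have bdd: "bdd_above (norm ` (A - U))"
      using rA bounded_norm_comp[of "\<lambda>x. x"] unfolding polar_decreasing_def by (metis Diff_subset bdd_above_norm bounded_subset)
    have le: "norm z \<le> \<gamma>" if "z \<in> A - U" for z
      unfolding \<gamma>_def using bdd that by (intro cSup_upper) auto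
    obtain z0 where z0: "z0 \<in> A - U" using False by blast
    then have "0 < norm z0" using Aq by (auto simp: quadrant_def)
    with le[OF z0] have \<gamma>: "0 < \<gamma>" by linarith
    have below: "z' \<in> A" if z': "z' \<in> quadrant" "z' \<in> U" "norm z' < \<gamma>" for z'
    proof -
      have "\<exists>x\<in>norm ` (A - U). norm z' < x"
        using less_cSup_iff[of "norm ` (A - U)" "norm z'"] bdd z0 z'(3) unfolding \<gamma>_def by blast
      then obtain z where z: "z \<in> A - U" "norm z' < norm z" by blast
      have "\<not> snd z * fst z' \<le> snd z' * fst z"
        using wedge[OF z'(2,1), of z] z Aq by blast
      then show ?thesis
        using rA z z'(1) unfolding polar_decreasing_def by (meson DiffD1 less_imp_le linear)
    qed
    have inside: "z' \<in> A" if z': "z' \<in> quadrant" "z' \<in> U" "norm z' \<le> \<gamma>" for z'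
    proof -
      have "q *\<^sub>R z' \<in> A" if q: "0 < q" "q < 1" for q
      proof (rule below)
        show "q *\<^sub>R z' \<in> quadrant" using z' q by (simp add: quadrant_scaleR)
        then show "q *\<^sub>R z' \<in> U" using wedge[OF z'(2,1)] by simp
        have "0 < norm z'" using z'(1) by (auto simp: quadrant_def)
        then have "q * norm z' < 1 * norm z'" by (intro mult_strict_right_mono q)
        then show "norm (q *\<^sub>R z') < \<gamma>" using q z'(3) by simp
      qed
      then show ?thesis using rA z'(1) unfolding polar_decreasing_def by blast
    qed
    have U_scale: "(1/\<gamma>) *\<^sub>R z \<in> U \<longleftrightarrow> z \<in> U" if "z \<in> quadrant" for z
    proof -
      have q: "(1/\<gamma>) *\<^sub>R z \<in> quadrant" using that \<gamma> quadrant_scaleR[of "1/\<gamma>" z] by simp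
      show ?thesis
        using wedge[of z "(1/\<gamma>) *\<^sub>R z"] wedge[of "(1/\<gamma>) *\<^sub>R z" z] q that by auto
    qed
    have B_scale: "(1/\<gamma>) *\<^sub>R z \<in> ?B \<longleftrightarrow> z \<in> quadrant \<and> norm z \<le> \<gamma>" for z
      using \<gamma> quadrant_scaleR[of "1/\<gamma>" z] by (simp add: field_simps)
    obtain k where k: "\<And>E. E \<in> sets borel \<Longrightarrow> ?m {z. (1/\<gamma>) *\<^sub>R z \<in> E} = k * ?m E"
      using cyl_measure_scale[OF unit dim, of "1/\<gamma>"] \<gamma> by (metis zero_less_divide_1_iff)
    have "k * ?m (?B \<inter> U) = ?m {z. (1/\<gamma>) *\<^sub>R z \<in> ?B \<inter> U}" by (rule k[symmetric]) auto
    also have "\<dots> \<le> ?m (A \<inter> U)"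
      using U_scale B_scale inside by (intro emeasure_mono) auto
    finally have 1: "k * ?m (?B \<inter> U) \<le> ?m (A \<inter> U)" .
    have "(\<lambda>z::real\<times>real. (1/\<gamma>) *\<^sub>R z) \<in> borel_measurable borel"
      by (intro borel_measurable_continuous_onI continuous_intros)
    from measurable_sets[OF this, of "?B - U"]
    have m: "{z. (1/\<gamma>) *\<^sub>R z \<in> ?B - U} \<in> sets borel" by (simp add: vimage_def)
    have "?m (A - U) \<le> ?m {z. (1/\<gamma>) *\<^sub>R z \<in> ?B - U}"
      using U_scale B_scale le Aq m by (intro emeasure_mono) auto
    also have "\<dots> = k * ?m (?B - U)" by (rule k) auto
    finally have 2: "?m (A - U) \<le> k * ?m (?B - U)" .
    have "?m (?B \<inter> U) * ?m (A - U) \<le> ?m (?B \<inter> U) * (k * ?m (?B - U))"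
      by (intro mult_left_mono 2) auto
    also have "\<dots> = (k * ?m (?B \<inter> U)) * ?m (?B - U)" by (simp add: mult_ac)
    also have "\<dots> \<le> ?m (A \<inter> U) * ?m (?B - U)" by (intro mult_right_mono 1) auto
    \<comment> \<open>Adding the products of the two parts inside the wedge to both sides gives the claim.\<close>
    finally have 3: "?m (?B \<inter> U) * ?m (A - U) \<le> ?m (A \<inter> U) * ?m (?B - U)" .
    have split: "?m X = ?m (X \<inter> U) + ?m (X - U)" if "X \<in> sets borel" for X
      using that by (subst plus_emeasure) (auto intro!: arg_cong[where f = ?m])
    have "?m (?B \<inter> U) * ?m A = ?m (?B \<inter> U) * ?m (A \<inter> U) + ?m (?B \<inter> U) * ?m (A - U)"
      by (subst split[of A]) (auto simp: distrib_left)
    also have "\<dots> \<le> ?m (?B \<inter> U) * ?m (A \<inter> U) + ?m (A \<inter> U) * ?m (?B - U)"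
      by (intro add_left_mono 3)
    also have "\<dots> = ?m (A \<inter> U) * ?m ?B"
      using split[of ?B] by (simp add: distrib_left mult.commute)
    finally show ?thesis .
  qed
qed

text \<open>
  The inequality compares shares: the cone \<open>V\<close> takes at least as large a fraction of the body of
  revolution generated by \<open>A\<close> as of the half-ball. In every slice through the axis the cone is a wedge,
  because it is invariant under scaling and under moving along \<open>e\<close>; and the slices of the two bodies of
  revolution are the same for all directions, so the inequality for wedges can be averaged.
\<close>
lemma cone_share:
  assumes A [measurable]: "A \<in> sets borel" and rA: "polar_decreasing A" and V [measurable]: "V \<in> sets borel"
    and eV: "e \<in> V" and cone: "\<And>y c k. y \<in> V \<Longrightarrow> 0 < c \<Longrightarrow> 0 \<le> k \<Longrightarrow> c *\<^sub>R y + k *\<^sub>R e \<in> V"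
  shows "emeasure lborel {y \<in> V. 0 < y \<bullet> e \<and> norm y \<le> 1} * emeasure lborel {y. 0 < y \<bullet> e \<and> cyl e y \<in> A}
     \<le> emeasure lborel {y \<in> V. 0 < y \<bullet> e \<and> cyl e y \<in> A} * emeasure lborel {y. 0 < y \<bullet> e \<and> norm (y::'a) \<le> 1}"
proof -
  let ?B = "quadrant \<inter> cball (0 :: real \<times> real) 1"
  let ?m = "emeasure (cyl_measure e)"
  let ?U = "\<lambda>\<omega>. {z. fst z *\<^sub>R e + snd z *\<^sub>R \<omega> \<in> V}"
  have U [measurable]: "?U \<omega> \<in> sets borel" for \<omega>
  proof -
    have "(\<lambda>z. fst z *\<^sub>R e + snd z *\<^sub>R \<omega>) \<in> borel_measurable borel"
      by (intro borel_measurable_continuous_onI continuous_intros)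
    from measurable_sets[OF this V] show ?thesis by (simp add: vimage_def)
  qed
  have B [measurable]: "?B \<in> sets borel" by auto
  have cylB: "0 < y \<bullet> e \<and> norm y \<le> 1 \<longleftrightarrow> 0 < y \<bullet> e \<and> cyl e y \<in> ?B" for y
    using norm_cyl[OF unit, of y] by (auto simp: quadrant_def cyl_def)
  have Int: "{z \<in> X. fst z *\<^sub>R e + snd z *\<^sub>R \<omega> \<in> V} = X \<inter> ?U \<omega>" for X \<omega> by auto
  have wedge: "z' \<in> ?U \<omega>" if z: "z \<in> ?U \<omega>" "z \<in> quadrant" "z' \<in> quadrant" "snd z' * fst z \<le> snd z * fst z'" for z z' \<omega>
  proof (cases "snd z' = 0")
    case True
    then show ?thesis using cone[OF eV, of "fst z'" 0] z(3) by (simp add: quadrant_def)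
  next
    case False
    with z(2-4) have pos: "0 < snd z'" "0 < snd z" 
      by (auto simp: quadrant_def order_less_le) (metis mult_eq_0_iff mult_nonneg_nonneg not_less less_eq_real_def mult_pos_pos)
    let ?c = "snd z' / snd z"
    have "?c *\<^sub>R (fst z *\<^sub>R e + snd z *\<^sub>R \<omega>) + (fst z' - ?c * fst z) *\<^sub>R e \<in> V"
      using z pos by (intro cone) (auto simp: field_simps)
    also have "?c *\<^sub>R (fst z *\<^sub>R e + snd z *\<^sub>R \<omega>) + (fst z' - ?c * fst z) *\<^sub>R e = fst z' *\<^sub>R e + snd z' *\<^sub>R \<omega>"
      using pos by (simp add: algebra_simps)
    finally show ?thesis by simp
  qed
  have "emeasure lborel {y \<in> V. 0 < y \<bullet> e \<and> norm y \<le> 1} * emeasure lborel {y. 0 < y \<bullet> e \<and> cyl e y \<in> A}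
     = (\<integral>\<^sup>+\<omega>. ?m (?B \<inter> ?U \<omega>) \<partial>dir_measure e) * ?m A"
    unfolding cylB emeasure_as_direction_average(2)[OF unit dim B V] emeasure_cyl_measure[OF A] Int ..
  also have "\<dots> = (\<integral>\<^sup>+\<omega>. ?m (?B \<inter> ?U \<omega>) * ?m A \<partial>dir_measure e)"
    using emeasure_as_direction_average(1)[OF unit dim B V] unfolding Int by (rule nn_integral_multc[symmetric])
  also have "\<dots> \<le> (\<integral>\<^sup>+\<omega>. ?m (A \<inter> ?U \<omega>) * ?m ?B \<partial>dir_measure e)"
    by (intro nn_integral_mono wedge_share[OF A rA U]) (rule wedge)
  also have "\<dots> = (\<integral>\<^sup>+\<omega>. ?m (A \<inter> ?U \<omega>) \<partial>dir_measure e) * ?m ?B"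
    using emeasure_as_direction_average(1)[OF unit dim A V] unfolding Int by (rule nn_integral_multc)
  also have "\<dots> = emeasure lborel {y \<in> V. 0 < y \<bullet> e \<and> cyl e y \<in> A} * emeasure lborel {y. 0 < y \<bullet> e \<and> norm (y::'a) \<le> 1}"
    unfolding cylB emeasure_as_direction_average(2)[OF unit dim A V] emeasure_cyl_measure[OF B] Int ..
  finally show ?thesis .
qed

end

section \<open>Spindles and half-spindles\<close>

text \<open>
  With \<open>r\<^sup>2 = h\<^sup>2 + l\<^sup>2\<close> the inequality says \<open>(fst z)\<^sup>2 + (snd z + h)\<^sup>2 \<le> r\<^sup>2\<close>: the region lies under the arc of
  radius \<open>r\<close> with centre \<open>(0, -h)\<close> that meets the axis in \<open>(l, 0)\<close>. Its rotation around the axis is one half of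
  the spindle with tips at distance \<open>l\<close> from the centre.
\<close>
definition spindle_profile :: "real \<Rightarrow> real \<Rightarrow> (real \<times> real) set" where
  "spindle_profile h l = {z \<in> quadrant. (norm z)\<^sup>2 + 2 * h * snd z \<le> l\<^sup>2}"

lemma spindle_profile_borel [measurable]: "spindle_profile h l \<in> sets borel"
proof -
  have "closed {z::real\<times>real. (norm z)\<^sup>2 + 2 * h * snd z \<le> l\<^sup>2}"
    by (intro closed_Collect_le continuous_intros)
  moreover have "spindle_profile h l = quadrant \<inter> {z. (norm z)\<^sup>2 + 2 * h * snd z \<le> l\<^sup>2}"
    by (auto simp: spindle_profile_def)
  ultimately show ?thesis by auto
qed

lemma polar_decreasing_spindle_profile:
  assumes h: "0 \<le> h" and l: "0 \<le> l"
  shows "polar_decreasing (spindle_profile h l)"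
  unfolding polar_decreasing_def
proof (intro conjI ballI allI impI)
  show "spindle_profile h l \<subseteq> quadrant" by (auto simp: spindle_profile_def)
  have "norm z \<le> l" if "z \<in> spindle_profile h l" for z
  proof -
    have "0 \<le> snd z" "(norm z)\<^sup>2 + 2 * h * snd z \<le> l\<^sup>2"
      using that by (simp_all add: spindle_profile_def quadrant_def)
    moreover from this have "0 \<le> 2 * h * snd z" using h by simp
    ultimately have "(norm z)\<^sup>2 \<le> l\<^sup>2" by linarith
    then show ?thesis using l by (rule power2_le_imp_le)
  qed
  then show "bounded (spindle_profile h l)" by (rule boundedI)
  fix z assume z: "z \<in> spindle_profile h l"
  fix z' assume z': "z' \<in> quadrant" "norm z' \<le> norm z" "snd z' * fst z \<le> snd z * fst z'"
  have zq: "0 < fst z" "0 \<le> snd z" "0 < fst z'" "0 \<le> snd z'"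
    using z z'(1) by (simp_all add: spindle_profile_def quadrant_def)
  have n2: "(norm z')\<^sup>2 \<le> (norm z)\<^sup>2" using z'(2) by (simp add: power_mono)
  have "snd z' \<le> snd z"
  proof (rule ccontr)
    assume c: "\<not> snd z' \<le> snd z"
    have "snd z' * fst z \<le> snd z' * fst z'"
      using z'(3) mult_right_mono[of "snd z" "snd z'" "fst z'"] c zq by linarith
    moreover have "0 < snd z'" using c zq(2) by linarith
    ultimately have "fst z \<le> fst z'" using mult_le_cancel_left_pos by blast
    then have "(fst z)\<^sup>2 \<le> (fst z')\<^sup>2" using zq by (intro power_mono) simp_all
    moreover have "(snd z)\<^sup>2 < (snd z')\<^sup>2" using c zq by (intro power_strict_mono) simp_all
    ultimately show False using n2 by (simp add: norm_prod_def)
  qed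
  then have "2 * h * snd z' \<le> 2 * h * snd z" using h by (simp add: mult_left_mono)
  moreover have "(norm z)\<^sup>2 + 2 * h * snd z \<le> l\<^sup>2" using z by (simp add: spindle_profile_def)
  ultimately have "(norm z')\<^sup>2 + 2 * h * snd z' \<le> l\<^sup>2" using n2 by linarith
  then show "z' \<in> spindle_profile h l" using z'(1) by (simp add: spindle_profile_def)
next
  fix z assume z: "z \<in> quadrant" "\<forall>q>0. q < 1 \<longrightarrow> q *\<^sub>R z \<in> spindle_profile h l"
  have "(norm z)\<^sup>2 + 2 * h * snd z \<le> l\<^sup>2"
  proof (rule field_le_mult_one_interval)
    fix q :: real assume q: "0 < q" "q < 1"
    let ?s = "sqrt q"
    have s: "0 < ?s" "?s < 1" "?s\<^sup>2 = q" using q by simp_all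
    have "?s * ?s \<le> ?s * 1" using s by (intro mult_left_mono) simp_all
    then have "q \<le> ?s" using s(3) by (simp add: power2_eq_square)
    then have "q * (2 * h * snd z) \<le> ?s * (2 * h * snd z)"
      using h z(1) by (intro mult_right_mono) (auto simp: quadrant_def)
    moreover have "(norm (?s *\<^sub>R z))\<^sup>2 + 2 * h * snd (?s *\<^sub>R z) \<le> l\<^sup>2"
      using z(2) s(1,2) unfolding spindle_profile_def by blast
    ultimately show "q * ((norm z)\<^sup>2 + 2 * h * snd z) \<le> l\<^sup>2"
      using q by (simp add: power_mult_distrib distrib_left mult.assoc mult.left_commute)
  qed
  then show "z \<in> spindle_profile h l" using z(1) by (simp add: spindle_profile_def)
qed

lemma inner_axis_perp:
  fixes e :: "'a::euclidean_space"
  assumes "norm e = 1"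
  shows "x \<bullet> y = (x \<bullet> e) * (y \<bullet> e) + perp e x \<bullet> perp e y"
  using inner_self[OF assms] by (simp add: perp_def inner_diff_left inner_diff_right inner_commute[of e x] inner_commute[of e y])

text \<open>
  Here \<open>x\<close> is the centre of a ball of radius \<open>r\<close>. If \<open>x\<close> is on the side of the tip \<open>l e\<close>, the bound
  \<open>norm x \<le> h\<close> suffices. If it is on the other side, then the ball has to contain the tip, which forces
  \<open>x\<close> closer to the origin by just the amount that the far side costs.
\<close>
lemma half_spindle_in_ball:
  fixes e x y :: "'a::euclidean_space"
  assumes e: "norm e = 1" and r: "0 \<le> r" "h\<^sup>2 + l\<^sup>2 = r\<^sup>2" and h: "0 \<le> h" and l: "0 \<le> l"
    and x: "norm x \<le> h" "dist x (l *\<^sub>R e) \<le> r"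
    and y: "0 \<le> y \<bullet> e" "(norm y)\<^sup>2 + 2 * h * norm (perp e y) \<le> l\<^sup>2"
  shows "dist x y \<le> r"
proof -
  let ?s = "y \<bullet> e" and ?a = "x \<bullet> e" and ?t = "norm (perp e y)"
  have dist2: "(dist x v)\<^sup>2 = (norm x)\<^sup>2 - 2 * (x \<bullet> v) + (norm v)\<^sup>2" for v
    unfolding dist_norm power2_norm_eq_inner by (simp add: inner_simps inner_commute)
  have "norm (perp e x) \<le> norm x"
    using norm_cyl[OF e, of x] norm_snd_le[where y = "norm (perp e x)" and x = "x \<bullet> e"] by (simp add: cyl_def)
  then have "\<bar>perp e x \<bullet> perp e y\<bar> \<le> h * ?t"
    using Cauchy_Schwarz_ineq2[of "perp e x" "perp e y"] x(1)
    by (meson mult_right_mono norm_ge_zero order_trans)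
  then have xy: "- 2 * (x \<bullet> y) \<le> - 2 * (?a * ?s) + 2 * h * ?t"
    using inner_axis_perp[OF e, of x y] by linarith
  have x2: "(norm x)\<^sup>2 \<le> h\<^sup>2" using x(1) by (simp add: power_mono)
  have "(dist x (l *\<^sub>R e))\<^sup>2 \<le> r\<^sup>2" using x(2) by (simp add: power_mono)
  then have xl: "(norm x)\<^sup>2 \<le> h\<^sup>2 + 2 * (?a * l)"
    using r(2) e unfolding dist2 by (simp add: power_mult_distrib mult_ac)
  have "(dist x y)\<^sup>2 \<le> r\<^sup>2"
  proof (cases "0 \<le> ?a")
    case True
    then have "0 \<le> ?a * ?s" using y(1) by simp
    then show ?thesis unfolding dist2 using xy x2 y(2) r(2) by linarith
  next
    case False
    have "(norm y)\<^sup>2 \<le> l\<^sup>2" using y(2) h mult_nonneg_nonneg[OF h norm_ge_zero, of "perp e y"] by linarith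
    then have "norm y \<le> l" using l by (rule power2_le_imp_le)
    then have "?s \<le> l" using norm_cauchy_schwarz[of y e] e by simp
    then have "?a * l \<le> ?a * ?s" using False by (intro mult_left_mono_neg) auto
    then show ?thesis unfolding dist2 using xy xl y(2) r(2) by linarith
  qed
  then show ?thesis using r(1) by (rule power2_le_imp_le)
qed

text \<open>
  The ball with centre \<open>m - h f\<close> has both tips on its boundary, for any unit vector \<open>f\<close> orthogonal to the axis;
  pointing \<open>f\<close> in the direction of \<open>perp e v\<close> yields the sharpest bound on \<open>v\<close>.
\<close>
lemma spindle_subset:
  fixes e m :: "'a::euclidean_space"
  assumes e: "norm e = 1" and dim: "2 \<le> DIM('a)" and r: "0 \<le> r" "h\<^sup>2 + l\<^sup>2 = r\<^sup>2"
    and v: "m + v \<in> ball_hull r {m + l *\<^sub>R e, m - l *\<^sub>R e}"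
  shows "(norm v)\<^sup>2 + 2 * h * norm (perp e v) \<le> l\<^sup>2"
proof -
  obtain f where f: "norm f = 1" "f \<bullet> e = 0" "v \<bullet> f = norm (perp e v)"
  proof (cases "perp e v = 0")
    case True
    obtain g where g: "g \<noteq> 0" "orthogonal e g" using orthogonal_to_vector_exists[OF dim] by metis
    have "v = (v \<bullet> e) *\<^sub>R e" using True by (simp add: perp_def)
    then have "v \<bullet> sgn g = (v \<bullet> e) * (e \<bullet> sgn g)" by (metis inner_scaleR_left)
    then show thesis using g True
      by (intro that[of "sgn g"]) (auto simp: norm_sgn orthogonal_def sgn_div_norm inner_commute)
  next
    case False
    have "perp e v \<bullet> e = 0" using inner_self[OF e] by (simp add: perp_def inner_simps)
    moreover from this have "v \<bullet> perp e v = (norm (perp e v))\<^sup>2"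
      by (simp add: perp_def inner_simps power2_norm_eq_inner inner_commute)
    ultimately show thesis using False
      by (intro that[of "sgn (perp e v)"]) (auto simp: norm_sgn sgn_div_norm power2_eq_square)
  qed
  let ?x = "m - h *\<^sub>R f"
  have d2: "(norm (h *\<^sub>R f + c *\<^sub>R w))\<^sup>2 = h\<^sup>2 + 2 * h * c * (f \<bullet> w) + c\<^sup>2 * (norm w)\<^sup>2" for c w
    unfolding power2_norm_eq_inner using f(1)
    by (simp add: inner_simps inner_commute norm_eq_1 power2_eq_square algebra_simps)
  have n: "norm (h *\<^sub>R f + c *\<^sub>R e) = r" if "c = l \<or> c = - l" for c
  proof (rule power2_eq_imp_eq)
    show "(norm (h *\<^sub>R f + c *\<^sub>R e))\<^sup>2 = r\<^sup>2"
      using that f(2) e r(2) by (auto simp: d2)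
  qed (use r(1) in auto)
  have D: "dist ?x (m + w) = norm (h *\<^sub>R f + w)" for w
  proof -
    have "m + w - ?x = h *\<^sub>R f + w" by simp
    then show ?thesis by (metis dist_commute dist_norm)
  qed
  have "{m + l *\<^sub>R e, m - l *\<^sub>R e} \<subseteq> cball ?x r"
    using n[of l] n[of "- l"] D[of "l *\<^sub>R e"] D[of "- l *\<^sub>R e"] by simp
  then have "m + v \<in> cball ?x r" using v unfolding ball_hull_def by blast
  then have "norm (h *\<^sub>R f + 1 *\<^sub>R v) \<le> r" using D[of v] by simp
  then have "(norm (h *\<^sub>R f + 1 *\<^sub>R v))\<^sup>2 \<le> r\<^sup>2" by (simp add: power_mono)
  then show ?thesis unfolding d2 using f(3) r(2) by (simp add: inner_commute)
qed

section \<open>The smallest enclosing ball\<close>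

text \<open>
  The pairs of centre and radius of enclosing balls, with the radius limited by that of one known ball,
  form a compact set, on which the radius attains its minimum.
\<close>
lemma least_enclosing_ball:
  fixes K :: "'a::euclidean_space set"
  assumes "bounded K" "K \<noteq> {}"
  shows "0 \<le> circumradius K" "\<exists>c. K \<subseteq> cball c (circumradius K)"
    "\<And>c \<rho>. 0 \<le> \<rho> \<Longrightarrow> K \<subseteq> cball c \<rho> \<Longrightarrow> circumradius K \<le> \<rho>"
proof -
  obtain p where p: "p \<in> K" using assms(2) by blast
  obtain R where R: "K \<subseteq> cball p R" 
    using assms(1) by (meson bounded_subset_cball bounded_iff bounded_any_center subset_eq mem_cball)
  have R0: "0 \<le> R" using R p by auto
  define C where "C = (cball p R \<times> {0..R}) \<inter> (\<Inter>q\<in>K. {z. dist (fst z) q \<le> snd z})"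
  have "compact C" unfolding C_def
    by (intro compact_Int_closed compact_Times compact_cball compact_Icc closed_INT ballI closed_Collect_le continuous_intros)
  moreover have pR: "(p, R) \<in> C" using R R0 by (auto simp: C_def)
  moreover have "continuous_on C snd" by (intro continuous_intros)
  ultimately have "\<exists>z\<in>C. \<forall>w\<in>C. snd z \<le> snd w"
    by (intro continuous_attains_inf) auto
  then obtain z where z: "z \<in> C" "\<And>w. w \<in> C \<Longrightarrow> snd z \<le> snd w" by blast
  have ex: "0 \<le> snd z" "K \<subseteq> cball (fst z) (snd z)" using z(1) by (auto simp: C_def mem_Times_iff)
  have min: "snd z \<le> \<rho>" if "0 \<le> \<rho>" "K \<subseteq> cball c \<rho>" for c \<rho>
  proof (cases "\<rho> \<le> R")
    case True
    have "dist c q \<le> \<rho>" if "q \<in> K" for q using \<open>K \<subseteq> cball c \<rho>\<close> that by auto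
    with True \<open>0 \<le> \<rho>\<close> p have "(c, \<rho>) \<in> C" by (force simp: C_def dist_commute)
    then show ?thesis using z(2) by fastforce
  next
    case False
    then show ?thesis using z(2)[OF pR] by simp
  qed
  have "circumradius K = snd z"
    unfolding circumradius_def using ex min by (intro Least_equality) auto
  then show "0 \<le> circumradius K" "\<exists>c. K \<subseteq> cball c (circumradius K)"
    "\<And>c \<rho>. 0 \<le> \<rho> \<Longrightarrow> K \<subseteq> cball c \<rho> \<Longrightarrow> circumradius K \<le> \<rho>" 
    using ex min by auto
qed

text \<open>
  Otherwise a small move of the centre in the direction \<open>x\<close> would bring it closer than the circumradius to every
  point of \<open>K\<close>: to the touching points because they are in front, to the others by continuity.
\<close>
lemma touching_points_surround:
  fixes K :: "'a::euclidean_space set"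
  assumes K: "finite K" "K \<noteq> {}" "K \<subseteq> cball c (circumradius K)"
  obtains p where "p \<in> K" "dist c p = circumradius K" "(p - c) \<bullet> x \<le> 0"
proof (rule ccontr)
  note found = that
  let ?\<rho> = "circumradius K"
  assume "\<not> thesis"
  then have pos: "0 < (p - c) \<bullet> x" if "p \<in> K" "dist c p = ?\<rho>" for p
    using found[OF that] \<open>\<not> thesis\<close> by linarith
  have "\<forall>\<^sub>F t in at_right 0. dist (c + t *\<^sub>R x) p < ?\<rho>" if p: "p \<in> K" for p
  proof (cases "dist c p = ?\<rho>")
    case True
    let ?a = "(p - c) \<bullet> x"
    have a: "0 < ?a" using pos p True by blast
    then have x: "0 < (norm x)\<^sup>2" by auto
    have "dist (c + t *\<^sub>R x) p < ?\<rho>" if t: "0 < t" "t < 2 * ?a / (norm x)\<^sup>2" for t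
    proof -
      have "(dist (c + t *\<^sub>R x) p)\<^sup>2 = (dist c p)\<^sup>2 - t * (2 * ?a - t * (norm x)\<^sup>2)"
        unfolding dist_norm power2_norm_eq_inner
        by (simp add: inner_simps inner_commute algebra_simps)
      moreover have "0 < t * (2 * ?a - t * (norm x)\<^sup>2)"
        using t x by (intro mult_pos_pos) (simp_all add: field_simps)
      ultimately have "(dist (c + t *\<^sub>R x) p)\<^sup>2 < ?\<rho>\<^sup>2" using True by simp
      then show ?thesis by (rule power2_less_imp_less) (metis True zero_le_dist)
    qed
    then show ?thesis unfolding eventually_at_right_field
      using a x by (intro exI[of _ "2 * ?a / (norm x)\<^sup>2"]) auto
  next
    case False
    then have "dist (c + 0 *\<^sub>R x) p < ?\<rho>" using K(3) p by force
    moreover have "((\<lambda>t. dist (c + t *\<^sub>R x) p) \<longlongrightarrow> dist (c + 0 *\<^sub>R x) p) (at_right 0)"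
      by (intro tendsto_intros)
    ultimately show ?thesis by (rule order_tendstoD(2)[rotated])
  qed
  then have "\<forall>\<^sub>F t in at_right (0::real). \<forall>p\<in>K. dist (c + t *\<^sub>R x) p < ?\<rho>"
    using K(1) by (simp add: eventually_ball_finite)
  then obtain t where t: "\<forall>p\<in>K. dist (c + t *\<^sub>R x) p < ?\<rho>"
    using eventually_happens' trivial_limit_at_right_real by blast
  let ?\<sigma> = "Max (dist (c + t *\<^sub>R x) ` K)"
  have "?\<sigma> < ?\<rho>" using t K by simp
  moreover have sub: "K \<subseteq> cball (c + t *\<^sub>R x) ?\<sigma>" using K(1) by auto
  moreover have "0 \<le> ?\<sigma>" using sub K(2) by (metis all_not_in_conv mem_cball order_trans subsetD zero_le_dist)
  ultimately show False
    using least_enclosing_ball(3)[OF finite_imp_bounded[OF K(1)] K(2)] by fastforce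
qed

section \<open>Symmetries of volume\<close>

lemma emeasure_lborel_translate:
  fixes c :: "'a::euclidean_space"
  assumes [measurable]: "A \<in> sets borel"
  shows "emeasure lborel {y. c + y \<in> A} = emeasure lborel A"
proof -
  have "emeasure (distr lborel borel ((+) c)) A = emeasure lborel ((+) c -` A)"
    by (subst emeasure_distr) auto
  then show ?thesis by (simp only: lborel_distr_plus vimage_def)
qed

text \<open>The reflection that exchanges \<open>e\<close> and \<open>f\<close>; it is the identity for \<open>e = f\<close>, where the divisor vanishes.\<close>
lemma reflection_exists:
  fixes e f :: "'a::euclidean_space"
  assumes e: "norm e = 1" "norm f = 1"
  obtains T where "linear T" "\<And>x. T (T x) = x" "\<And>x. norm (T x) = norm x" "\<And>x. T x \<bullet> e = x \<bullet> f"
proof -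
  let ?n = "e - f"
  define T where "T x = x - (2 * (x \<bullet> ?n) / (?n \<bullet> ?n)) *\<^sub>R ?n" for x :: 'a
  have lin: "linear T"
    unfolding T_def by (rule linearI) (auto simp: inner_simps algebra_simps add_divide_distrib diff_divide_distrib)
  have Tn: "T x \<bullet> ?n = - (x \<bullet> ?n)" for x
    by (cases "?n = 0") (simp_all add: T_def inner_diff_left[of x])
  have "T (T x) = T x - (2 * (T x \<bullet> ?n) / (?n \<bullet> ?n)) *\<^sub>R ?n" for x by (simp add: T_def)
  then have inv: "T (T x) = x" for x unfolding Tn by (simp add: T_def)
  have "T x \<bullet> T x = x \<bullet> x" for x
  proof -
    have "T x \<bullet> T x = T x \<bullet> x - (2 * (x \<bullet> ?n) / (?n \<bullet> ?n)) * (T x \<bullet> ?n)"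
      by (subst (2) T_def) (simp add: inner_diff_right)
    also have "T x \<bullet> x = x \<bullet> x - (2 * (x \<bullet> ?n) / (?n \<bullet> ?n)) * (x \<bullet> ?n)"
      by (simp only: T_def inner_diff_left[of x] inner_scaleR_left inner_commute[of ?n x])
    also have "x \<bullet> x - (2 * (x \<bullet> ?n) / (?n \<bullet> ?n)) * (x \<bullet> ?n) - (2 * (x \<bullet> ?n) / (?n \<bullet> ?n)) * (T x \<bullet> ?n) = x \<bullet> x"
      unfolding Tn by linarith
    finally show ?thesis .
  qed
  then have nrm: "norm (T x) = norm x" for x by (simp add: norm_eq_sqrt_inner)
  have "T x \<bullet> e = x \<bullet> f" for x
  proof (cases "?n = 0")
    case True
    then show ?thesis by (simp add: T_def)
  next
    case False
    have ee: "e \<bullet> e = 1" "f \<bullet> f = 1" using e by (simp_all add: norm_eq_1)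
    then have nn: "?n \<bullet> ?n = 2 * (?n \<bullet> e)"
      by (simp add: inner_diff_left inner_diff_right inner_commute)
    then have ne: "?n \<bullet> e \<noteq> 0" using False by (metis inner_eq_zero_iff mult_zero_right)
    have "T x \<bullet> e = x \<bullet> e - (2 * (x \<bullet> ?n) / (?n \<bullet> ?n)) * (?n \<bullet> e)"
      by (simp only: T_def inner_diff_left[of x] inner_scaleR_left)
    also have "\<dots> = x \<bullet> e - x \<bullet> ?n" unfolding nn using ne by simp
    finally show ?thesis by (simp add: inner_diff_right)
  qed
  with lin inv nrm show thesis using that by blast
qed

lemma emeasure_cyl_rotate:
  fixes e f :: "'a::euclidean_space"
  assumes e: "norm e = 1" "norm f = 1" and A [measurable]: "A \<in> sets borel"
  shows "emeasure lborel {y. 0 < y \<bullet> f \<and> cyl f y \<in> A} = emeasure lborel {y. 0 < y \<bullet> e \<and> cyl e y \<in> A}"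
proof -
  obtain T where T: "linear T" "\<And>x. T (T x) = x" "\<And>x. norm (T x) = norm x" "\<And>x. T x \<bullet> e = x \<bullet> f"
    using reflection_exists[OF e] by metis
  have "cyl e (T x) = cyl f x" for x
  proof -
    have "(snd (cyl g z))\<^sup>2 = (norm z)\<^sup>2 - (z \<bullet> g)\<^sup>2" if "norm g = 1" for g z :: 'a
      unfolding norm_cyl[OF that, of z, symmetric] by (simp add: cyl_def norm_prod_def)
    then have "(snd (cyl e (T x)))\<^sup>2 = (snd (cyl f x))\<^sup>2" using e T by simp
    then have "snd (cyl e (T x)) = snd (cyl f x)" by (rule power2_eq_imp_eq) (auto simp: cyl_def)
    then show ?thesis using T(4) by (simp add: cyl_def)
  qed
  then have vim: "T -` {y. 0 < y \<bullet> e \<and> cyl e y \<in> A} = {y. 0 < y \<bullet> f \<and> cyl f y \<in> A}"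
    using T(4) by auto
  have "{y. 0 < y \<bullet> e \<and> cyl e y \<in> A} \<in> sets borel" by measurable
  from emeasure_isometry_vimage[OF T(1,2,3) this] show ?thesis unfolding vim .
qed

lemma emeasure_symmetric_halves:
  fixes e :: "'a::euclidean_space"
  assumes e: "e \<noteq> 0" and Q [measurable]: "Q \<in> sets borel" and sym: "\<And>y. - y \<in> Q \<longleftrightarrow> y \<in> Q"
  shows "emeasure lborel Q = 2 * emeasure lborel {y \<in> Q. 0 < y \<bullet> e}"
proof -
  let ?p = "{y \<in> Q. 0 < y \<bullet> e}" and ?n = "{y \<in> Q. y \<bullet> e < 0}" and ?z = "{y \<in> Q. y \<bullet> e = 0}"
  have m: "?p \<in> sets lborel" "?n \<in> sets lborel" "?z \<in> sets lborel" by measurable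
  have "negligible ?z" by (rule negligible_subset[OF negligible_hyperplane[of e 0]]) (use e in \<open>auto simp: inner_commute\<close>)
  then have z: "emeasure lborel ?z = 0" using negligible_iff_emeasure_lborel[of ?z] m(3) by simp
  have "(\<lambda>y. - y) -` ?p = ?n" using sym by auto
  then have n: "emeasure lborel ?n = emeasure lborel ?p"
    using emeasure_isometry_vimage[of uminus uminus ?p] m(1) by (simp add: linear_uminus)
  have "Q = (?p \<union> ?n) \<union> ?z" by auto
  then have "emeasure lborel Q = emeasure lborel (?p \<union> ?n) + emeasure lborel ?z"
    using m by (subst plus_emeasure) auto
  also have "\<dots> = emeasure lborel ?p + emeasure lborel ?n"
    using m z by (subst plus_emeasure) auto
  finally show ?thesis using n by (simp add: mult_2)
qed

section \<open>Cells of points on a sphere\<close>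

text \<open>For vectors of equal length, this is the open Voronoi cell of \<open>u\<close> in \<open>U\<close>.\<close>
definition cell :: "'a::euclidean_space set \<Rightarrow> 'a \<Rightarrow> 'a set" where
  "cell U u = {y. \<forall>v\<in>U - {u}. y \<bullet> v < y \<bullet> u}"

lemma cell_borel [measurable]: "finite U \<Longrightarrow> cell U u \<in> sets borel"
proof -
  assume "finite U"
  have "cell U u = (\<Inter>v\<in>U - {u}. {y. y \<bullet> v < y \<bullet> u})" by (auto simp: cell_def)
  moreover have "open (\<Inter>v\<in>U - {u}. {y. y \<bullet> v < y \<bullet> u})"
    using \<open>finite U\<close> by (intro open_INT ballI open_Collect_less continuous_intros) auto
  ultimately show ?thesis by simp
qed

lemma cell_disjoint:
  assumes "u \<in> U" "v \<in> U" "u \<noteq> v"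
  shows "cell U u \<inter> cell U v = {}"
proof -
  have False if "y \<in> cell U u" "y \<in> cell U v" for y
  proof -
    have "y \<bullet> v < y \<bullet> u" "y \<bullet> u < y \<bullet> v" using that assms by (auto simp: cell_def)
    then show False by simp
  qed
  then show ?thesis by blast
qed

text \<open>
  A point \<open>y\<close> off the finitely many hyperplanes where \<open>y \<bullet> u = y \<bullet> v\<close> or \<open>y \<bullet> u = 0\<close> belongs to the cell of the
  unique \<open>u\<close> that maximises \<open>y \<bullet> u\<close>, and the maximum is positive because \<open>U\<close> surrounds the origin.
\<close>
lemma cells_cover_ball:
  fixes U :: "'a::euclidean_space set"
  assumes U: "finite U" "0 \<notin> U" and surround: "\<And>x. \<exists>u\<in>U. u \<bullet> x \<le> 0"
  shows "emeasure lborel (cball (0::'a) 1) \<le> (\<Sum>u\<in>U. emeasure lborel {y \<in> cell U u. 0 < y \<bullet> u \<and> norm y \<le> 1})"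
proof -
  let ?N = "(\<Union>u\<in>U. \<Union>v\<in>U - {u}. {y. (u - v) \<bullet> y = 0}) \<union> (\<Union>u\<in>U. {y. u \<bullet> y = 0})"
  let ?C = "\<lambda>u. {y \<in> cell U u. 0 < y \<bullet> u \<and> norm y \<le> 1}"
  have "negligible ?N"
  proof (intro negligible_Un negligible_Union)
    show "finite ((\<lambda>u. \<Union>v\<in>U - {u}. {y. (u - v) \<bullet> y = 0}) ` U)" "finite ((\<lambda>u. {y. u \<bullet> y = 0}) ` U)"
      using U(1) by auto
    show "negligible t" if "t \<in> (\<lambda>u. \<Union>v\<in>U - {u}. {y. (u - v) \<bullet> y = 0}) ` U" for t
      using that U(1) by (auto intro!: negligible_Union negligible_hyperplane)
    show "negligible t" if "t \<in> (\<lambda>u. {y. u \<bullet> y = 0}) ` U" for t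
      using that U(2) by (auto intro!: negligible_hyperplane)
  qed
  moreover have N: "?N \<in> sets borel"
    using U(1) by (intro sets.Un sets.finite_UN borel_closed closed_hyperplane finite_Diff) auto
  ultimately have N0: "emeasure lborel ?N = 0" using negligible_iff_emeasure_lborel by blast
  have C: "?C u \<in> sets borel" for u using U(1) by measurable
  have UC: "(\<Union>u\<in>U. ?C u) \<in> sets borel" using C U(1) by (intro sets.finite_UN) simp_all
  have "cball 0 1 \<subseteq> (\<Union>u\<in>U. ?C u) \<union> ?N"
  proof
    fix y :: 'a assume y: "y \<in> cball 0 1"
    show "y \<in> (\<Union>u\<in>U. ?C u) \<union> ?N"
    proof (cases "y \<in> ?N")
      case False
      have ne: "y \<bullet> u \<noteq> y \<bullet> v" if "u \<in> U" "v \<in> U" "u \<noteq> v" for u v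
      proof -
        have "(u - v) \<bullet> y \<noteq> 0" using False that by blast
        then show ?thesis by (simp add: inner_diff_left inner_commute[of y])
      qed
      have "U \<noteq> {}" using surround[of 0] by blast
      then have "Max ((\<bullet>) y ` U) \<in> (\<bullet>) y ` U" using U(1) by (intro Max_in) auto
      then obtain u where u: "u \<in> U" "y \<bullet> u = Max ((\<bullet>) y ` U)" by fastforce
      have max: "y \<bullet> v \<le> y \<bullet> u" if "v \<in> U" for v
        unfolding u(2) using that U(1) by (intro Max_ge) auto
      have "y \<in> cell U u" unfolding cell_def using u(1) max ne by (auto simp: order_less_le)
      moreover obtain v where "v \<in> U" "v \<bullet> (- y) \<le> 0" using surround[of "- y"] by blast
      then have "0 \<le> y \<bullet> u" using max[of v] by (simp add: inner_commute)
      moreover have "y \<bullet> u \<noteq> 0" using False u(1) by (auto simp: inner_commute)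
      ultimately show ?thesis using u(1) y by auto
    qed simp
  qed
  then have "emeasure lborel (cball (0::'a) 1) \<le> emeasure lborel ((\<Union>u\<in>U. ?C u) \<union> ?N)"
    using sets.Un[OF UC N] by (intro emeasure_mono) simp_all
  also have "\<dots> \<le> emeasure lborel (\<Union>u\<in>U. ?C u) + emeasure lborel ?N"
    using UC N by (intro emeasure_subadditive) simp_all
  also have "\<dots> \<le> (\<Sum>u\<in>U. emeasure lborel (?C u))"
    unfolding N0 add_0_right using C U(1) by (intro emeasure_subadditive_finite) auto
  finally show ?thesis .
qed

section \<open>The volume of the ball hull\<close>

lemma ball_hull_borel [measurable]: "ball_hull r K \<in> sets borel"
  unfolding ball_hull_def by (intro borel_closed closed_Inter) auto

lemma emeasure_ball_hull_finite:
  assumes "K \<subseteq> cball c r"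
  shows "emeasure lborel (ball_hull r K) < \<infinity>"
proof -
  have "ball_hull r K \<subseteq> cball c r" using assms unfolding ball_hull_def by blast
  then have "emeasure lborel (ball_hull r K) \<le> emeasure lborel (cball c r)"
    by (intro emeasure_mono) auto
  then show ?thesis using emeasure_lborel_cball_finite le_less_trans by blast
qed

lemma subset_ball_hull: "K \<subseteq> ball_hull r K"
  unfolding ball_hull_def by blast

text \<open>
  The circumradius of a spindle is half the distance of its tips: the spindle lies in the ball
  with the tips as antipodes by \<open>spindle_subset\<close>.
\<close>
lemma spindle_of_circumradiusE:
  fixes S :: "'a::euclidean_space set"
  assumes dim: "2 \<le> DIM('a)" and S: "is_spindle_of_circumradius r l S"
  obtains m e where "norm e = 1" "0 < l" "l \<le> r" "S = ball_hull r {m + l *\<^sub>R e, m - l *\<^sub>R e}"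
proof -
  obtain x y where xy: "0 < norm (x - y)" "norm (x - y) \<le> 2 * r" "S = ball_hull r {x, y}"
    using S unfolding is_spindle_of_circumradius_def is_spindle_def by blast
  have circ: "circumradius S = l" using S by (simp add: is_spindle_of_circumradius_def)
  define k where "k = norm (x - y) / 2"
  define e where "e = sgn (x - y)"
  define m where "m = (1/2) *\<^sub>R (x + y)"
  have k: "0 < k" "k \<le> r" using xy by (auto simp: k_def)
  have e: "norm e = 1" using xy(1) by (simp add: e_def norm_sgn)
  have "k *\<^sub>R e = (1/2) *\<^sub>R (x - y)" using xy(1) by (simp add: k_def e_def sgn_div_norm)
  then have "m + k *\<^sub>R e = (1/2) *\<^sub>R ((x + y) + (x - y))" "m - k *\<^sub>R e = (1/2) *\<^sub>R ((x + y) - (x - y))"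
    by (simp_all only: m_def scaleR_right_distrib scaleR_right_diff_distrib)
  moreover have "(x + y) + (x - y) = x + x" "(x + y) - (x - y) = y + y" by simp_all
  ultimately have ends: "m + k *\<^sub>R e = x" "m - k *\<^sub>R e = y" by (simp_all only: scaleR_half_double)
  have Sm: "S = ball_hull r {m + k *\<^sub>R e, m - k *\<^sub>R e}" using xy(3) ends by simp
  define h where "h = sqrt (r\<^sup>2 - k\<^sup>2)"
  have "k\<^sup>2 \<le> r\<^sup>2" using k by (simp add: power_mono)
  then have h: "0 \<le> h" "h\<^sup>2 + k\<^sup>2 = r\<^sup>2" by (simp_all add: h_def)
  have "S \<subseteq> cball m k"
  proof
    fix z assume "z \<in> S"
    then have "m + (z - m) \<in> ball_hull r {m + k *\<^sub>R e, m - k *\<^sub>R e}" using Sm by simp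
    then have "(norm (z - m))\<^sup>2 + 2 * h * norm (perp e (z - m)) \<le> k\<^sup>2"
      using k by (intro spindle_subset[where m = m, OF e dim _ h(2)]) auto
    moreover have "0 \<le> 2 * h * norm (perp e (z - m))" using h by simp
    ultimately have "(norm (z - m))\<^sup>2 \<le> k\<^sup>2" by linarith
    then have "norm (z - m) \<le> k" by (rule power2_le_imp_le) (use k in simp)
    then show "z \<in> cball m k" by (simp add: dist_norm norm_minus_commute)
  qed
  moreover have "k \<le> \<rho>" if "S \<subseteq> cball c \<rho>" for c \<rho>
  proof -
    have "x \<in> S" "y \<in> S" using subset_ball_hull[of "{x, y}" r] xy(3) by auto
    then have "dist x c \<le> \<rho>" "dist c y \<le> \<rho>" using that by (auto simp: dist_commute)
    then have "dist x y \<le> 2 * \<rho>" using dist_triangle[of x y c] by linarith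
    then show ?thesis by (simp add: k_def dist_norm)
  qed
  ultimately have "circumradius S = k"
    unfolding circumradius_def using k by (intro Least_equality) auto
  then have "k = l" using circ by simp
  then show thesis using that e k Sm by blast
qed

text \<open>
  A ball of radius \<open>r\<close> and centre \<open>x\<close> that contains \<open>P\<close> satisfies \<open>norm (x - c) \<le> h\<close>: some touching point \<open>q\<close>
  makes an angle of at least a right angle with \<open>x - c\<close>, whence
  \<open>(norm (x - c))\<^sup>2 + l\<^sup>2 \<le> (dist q x)\<^sup>2 \<le> r\<^sup>2\<close>. Then \<open>half_spindle_in_ball\<close> applies.
\<close>
lemma half_spindles_in_ball_hull:
  fixes P :: "'a::euclidean_space set"
  assumes P: "P \<subseteq> cball c l" and l: "0 < l" "l \<le> r" and h: "0 \<le> h" "h\<^sup>2 + l\<^sup>2 = r\<^sup>2"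
    and surround: "\<And>x. \<exists>p\<in>P. dist c p = l \<and> (p - c) \<bullet> x \<le> 0"
    and p: "p \<in> P" "dist c p = l"
    and y: "0 < y \<bullet> (p - c)" "cyl ((1/l) *\<^sub>R (p - c)) y \<in> spindle_profile h l"
  shows "c + y \<in> ball_hull r P"
  unfolding ball_hull_def
proof (clarsimp simp: dist_commute)
  define e where "e = (1/l) *\<^sub>R (p - c)"
  fix x assume x: "P \<subseteq> cball x r"
  have sq: "(dist q x)\<^sup>2 = (norm (q - c))\<^sup>2 - 2 * ((q - c) \<bullet> (x - c)) + (norm (x - c))\<^sup>2" for q
  proof -
    have "(norm (a - b))\<^sup>2 = (norm a)\<^sup>2 - 2 * (a \<bullet> b) + (norm b)\<^sup>2" for a b :: 'a
      unfolding power2_norm_eq_inner by (simp add: inner_simps inner_commute)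
    from this[of "q - c" "x - c"] show ?thesis by (simp add: dist_norm)
  qed
  have n: "norm (q - c) = l" if "dist c q = l" for q using that by (simp add: dist_norm norm_minus_commute)
  have e: "norm e = 1" using n[OF p(2)] l by (simp add: e_def)
  obtain q where q: "q \<in> P" "dist c q = l" "(q - c) \<bullet> (x - c) \<le> 0" using surround by blast
  have "dist q x \<le> r" using q(1) x by (auto simp: dist_commute)
  then have "(dist q x)\<^sup>2 \<le> r\<^sup>2" by (simp add: power_mono)
  then have "(norm (x - c))\<^sup>2 \<le> h\<^sup>2" unfolding sq n[OF q(2)] using h(2) q(3) by linarith
  then have xh: "norm (x - c) \<le> h" using h(1) by (rule power2_le_imp_le)
  have "l *\<^sub>R e = p - c" using l by (simp add: e_def)
  then have "dist (x - c) (l *\<^sub>R e) = dist x p" by (simp add: dist_norm)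
  also have "\<dots> \<le> r" using p(1) x by auto
  finally have xp: "dist (x - c) (l *\<^sub>R e) \<le> r" .
  have prof: "(norm y)\<^sup>2 + 2 * h * norm (perp e y) \<le> l\<^sup>2"
    using y(2) norm_cyl[OF e, of y] unfolding e_def[symmetric] by (simp add: spindle_profile_def cyl_def)
  have "dist (x - c) y \<le> r"
  proof (rule half_spindle_in_ball[OF e _ h(2) h(1) _ xh xp _ prof])
    show "0 \<le> y \<bullet> e" using l y(1) by (simp add: e_def)
  qed (use l in auto)
  then show "dist x (c + y) \<le> r" by (simp add: dist_norm diff_diff_eq)
qed

lemma emeasure_spindle_le:
  fixes S :: "'a::euclidean_space set"
  assumes e: "norm e = 1" and dim: "2 \<le> DIM('a)" and r: "0 \<le> r" "h\<^sup>2 + l\<^sup>2 = r\<^sup>2"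
    and S: "S = ball_hull r {m + l *\<^sub>R e, m - l *\<^sub>R e}"
  shows "emeasure lborel S \<le> 2 * emeasure lborel {y. 0 < y \<bullet> e \<and> cyl e y \<in> spindle_profile h l}"
proof -
  let ?D = "{v::'a. (norm v)\<^sup>2 + 2 * h * norm (perp e v) \<le> l\<^sup>2}"
  have D [measurable]: "?D \<in> sets borel" by measurable
  have "emeasure lborel S = emeasure lborel {v. m + v \<in> S}"
    by (rule emeasure_lborel_translate[symmetric]) (simp add: S)
  also have "\<dots> \<le> emeasure lborel ?D"
    using spindle_subset[OF e dim r] D by (intro emeasure_mono) (auto simp: S)
  also have "\<dots> = 2 * emeasure lborel {y \<in> ?D. 0 < y \<bullet> e}"
    using e linear_neg[OF linear_perp, of e] by (intro emeasure_symmetric_halves D) auto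
  also have "{y \<in> ?D. 0 < y \<bullet> e} = {y. 0 < y \<bullet> e \<and> cyl e y \<in> spindle_profile h l}"
    using norm_cyl[OF e] by (auto simp: spindle_profile_def quadrant_def cyl_def)
  finally show ?thesis .
qed

lemma emeasure_half_ball:
  fixes e :: "'a::euclidean_space"
  assumes "e \<noteq> 0"
  shows "emeasure lborel (cball (0::'a) 1) = 2 * emeasure lborel {y. 0 < y \<bullet> e \<and> norm y \<le> 1}"
    using emeasure_symmetric_halves[OF assms, of "cball 0 1"] by (simp add: conj_commute)

lemma emeasure_spindle_le_ball_hull:
  fixes P S :: "'a::euclidean_space set"
  assumes dim: "2 \<le> DIM('a)" and P: "finite P" "P \<noteq> {}" "circumradius P = l"
    and S: "is_spindle_of_circumradius r l S"
  shows "emeasure lborel S \<le> emeasure lborel (ball_hull r P)"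
proof -
  obtain m e where e: "norm e = 1" and l: "0 < l" "l \<le> r" and Sm: "S = ball_hull r {m + l *\<^sub>R e, m - l *\<^sub>R e}"
    by (rule spindle_of_circumradiusE[OF dim S])
  define h where "h = sqrt (r\<^sup>2 - l\<^sup>2)"
  have "l\<^sup>2 \<le> r\<^sup>2" using l by (simp add: power_mono)
  then have h: "0 \<le> h" "h\<^sup>2 + l\<^sup>2 = r\<^sup>2" by (simp_all add: h_def)
  obtain c where c: "P \<subseteq> cball c l"
    using least_enclosing_ball(2)[OF finite_imp_bounded[OF P(1)] P(2)] P(3) by auto
  have surround: "\<exists>p\<in>P. dist c p = l \<and> (p - c) \<bullet> x \<le> 0" for x
    using touching_points_surround[OF P(1,2), of c x] c P(3) by blast
  define U where "U = {u. c + u \<in> P \<and> norm u = l}"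
  have U: "finite U" 
  proof -
    have "U \<subseteq> (\<lambda>p. p - c) ` P" unfolding U_def by force
    then show ?thesis using P(1) finite_surj by blast
  qed
  have U0: "0 \<notin> U" using l by (simp add: U_def)
  have Us: "\<exists>u\<in>U. u \<bullet> x \<le> 0" for x
  proof -
    obtain p where "p \<in> P" "dist c p = l" "(p - c) \<bullet> x \<le> 0" using surround by blast
    then show ?thesis by (intro bexI[of _ "p - c"]) (auto simp: U_def dist_norm norm_minus_commute)
  qed
  let ?A = "spindle_profile h l" and ?H = "ball_hull r P"
  let ?s = "emeasure lborel {y. 0 < y \<bullet> e \<and> cyl e y \<in> ?A}"
  let ?b = "emeasure lborel {y. 0 < y \<bullet> e \<and> norm (y::'a) \<le> 1}"
  let ?C = "\<lambda>u. {y \<in> cell U u. 0 < y \<bullet> u \<and> cyl ((1/l) *\<^sub>R u) y \<in> ?A}"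
  let ?B = "\<lambda>u. {y \<in> cell U u. 0 < y \<bullet> u \<and> norm y \<le> 1}"
  have C: "?C u \<in> sets borel" for u using U by measurable
  have ball: "emeasure lborel (cball (0::'a) 1) = 2 * ?b" using e by (intro emeasure_half_ball) auto
  have share: "emeasure lborel (?B u) * ?s \<le> emeasure lborel (?C u) * ?b" if u: "u \<in> U" for u
  proof -
    let ?f = "(1/l) *\<^sub>R u"
    have nu: "norm u = l" using u by (simp add: U_def)
    have f: "norm ?f = 1" using nu l by simp
    have pos: "0 < y \<bullet> ?f \<longleftrightarrow> 0 < y \<bullet> u" for y using l by (simp add: zero_less_divide_iff)
    have less: "?f \<bullet> v < ?f \<bullet> u" if "v \<in> U - {u}" for v
    proof -
      have "0 < (norm (u - v))\<^sup>2" using that by auto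
      also have "(norm (u - v))\<^sup>2 = 2 * (u \<bullet> u - u \<bullet> v)"
      proof -
        have "v \<bullet> v = u \<bullet> u" using that nu by (simp add: U_def flip: power2_norm_eq_inner)
        then show ?thesis unfolding power2_norm_eq_inner by (simp add: inner_simps inner_commute)
      qed
      finally show ?thesis using l by (simp add: divide_strict_right_mono)
    qed
    have "emeasure lborel {y \<in> cell U u. 0 < y \<bullet> ?f \<and> norm y \<le> 1} * emeasure lborel {y. 0 < y \<bullet> ?f \<and> cyl ?f y \<in> ?A}
     \<le> emeasure lborel {y \<in> cell U u. 0 < y \<bullet> ?f \<and> cyl ?f y \<in> ?A} * emeasure lborel {y. 0 < y \<bullet> ?f \<and> norm (y::'a) \<le> 1}"
    proof (rule cone_share[OF f dim])
      show "polar_decreasing ?A" using h(1) l by (intro polar_decreasing_spindle_profile) auto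
      show "cell U u \<in> sets borel" using U by (rule cell_borel)
      show "?f \<in> cell U u" unfolding cell_def using less by blast
      show "a *\<^sub>R y + k *\<^sub>R ?f \<in> cell U u" if "y \<in> cell U u" "0 < a" "0 \<le> k" for y a k
        unfolding cell_def
      proof (intro CollectI ballI)
        fix v assume v: "v \<in> U - {u}"
        have "a * (y \<bullet> v) < a * (y \<bullet> u)" using that v by (simp add: cell_def)
        moreover have "k * (?f \<bullet> v) \<le> k * (?f \<bullet> u)"
          using less[OF v] that(3) by (intro mult_left_mono) auto
        ultimately show "(a *\<^sub>R y + k *\<^sub>R ?f) \<bullet> v < (a *\<^sub>R y + k *\<^sub>R ?f) \<bullet> u"
          by (simp only: inner_add_left inner_scaleR_left)
      qed
    qed auto
    moreover have "emeasure lborel {y. 0 < y \<bullet> ?f \<and> cyl ?f y \<in> ?A} = ?s"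
      by (rule emeasure_cyl_rotate[OF e f]) simp
    moreover have "emeasure lborel {y. 0 < y \<bullet> ?f \<and> norm (y::'a) \<le> 1} = ?b"
      using emeasure_cyl_rotate[OF e f, of "cball 0 1"] norm_cyl[OF e] norm_cyl[OF f] by simp
    ultimately show ?thesis unfolding pos by simp
  qed
  have "(\<Sum>u\<in>U. emeasure lborel (?C u)) = emeasure lborel (\<Union>u\<in>U. ?C u)"
    using C U cell_disjoint[of _ U] by (intro sum_emeasure) (auto simp: disjoint_family_on_def)
  also have "\<dots> \<le> emeasure lborel {y. c + y \<in> ?H}"
  proof (rule emeasure_mono)
    show "(\<Union>u\<in>U. ?C u) \<subseteq> {y. c + y \<in> ?H}"
    proof clarsimp
      fix u y assume "u \<in> U" "0 < y \<bullet> u" "cyl ((1/l) *\<^sub>R u) y \<in> ?A"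
      then show "c + y \<in> ?H"
        using half_spindles_in_ball_hull[OF c l h surround, of "c + u" y] by (simp add: U_def dist_norm)
    qed
  qed simp
  also have "\<dots> = emeasure lborel ?H" by (rule emeasure_lborel_translate) simp
  finally have hull: "(\<Sum>u\<in>U. emeasure lborel (?C u)) \<le> emeasure lborel ?H" .
  have "?b * emeasure lborel S \<le> ?b * (2 * ?s)"
    using emeasure_spindle_le[OF e dim _ h(2) Sm] l by (intro mult_left_mono) auto
  also have "\<dots> = emeasure lborel (cball (0::'a) 1) * ?s" by (simp add: ball mult_ac)
  also have "\<dots> \<le> (\<Sum>u\<in>U. emeasure lborel (?B u)) * ?s"
    by (intro mult_right_mono cells_cover_ball U U0 Us) auto
  also have "\<dots> = (\<Sum>u\<in>U. emeasure lborel (?B u) * ?s)" by (rule sum_distrib_right)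
  also have "\<dots> \<le> (\<Sum>u\<in>U. emeasure lborel (?C u) * ?b)" by (intro sum_mono share)
  also have "\<dots> = (\<Sum>u\<in>U. emeasure lborel (?C u)) * ?b" by (rule sum_distrib_right[symmetric])
  also have "\<dots> \<le> emeasure lborel ?H * ?b" by (intro mult_right_mono hull) auto
  finally have main: "?b * emeasure lborel S \<le> ?b * emeasure lborel ?H" by (simp add: mult.commute)
  have "0 < emeasure lborel (cball (0::'a) 1)" "emeasure lborel (cball (0::'a) 1) < \<infinity>"
    by (simp_all add: emeasure_cball unit_ball_vol_pos)
  then have "?b \<noteq> 0" "?b \<noteq> \<infinity>" unfolding ball by (auto simp: ennreal_mult_eq_top_iff)
  then show ?thesis using main by (simp add: ennreal_mult_le_mult_iff less_top)
qed

text \<open>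
  It remains to pass from extended volumes to \<^const>\<open>measure\<close>, which is monotone here because the ball hull
  has finite volume: as \<open>r0 < r\<close>, some ball of radius \<open>r\<close> contains \<open>P\<close>.
\<close>
theorem theorem7:
  fixes r r0 :: real and N :: nat
    and p :: "nat \<Rightarrow> 'a::euclidean_space" and P S :: "'a set"
  assumes "r > r0" and "r0 > 0"
    and "N > 1" and "DIM('a) > 1"
    and "P = p ` {1..N}"
    and "circumradius P = r0"
    and "is_spindle_of_circumradius r r0 S"
  shows "measure lebesgue S \<le> measure lebesgue (ball_hull r P)"
proof -
  have fin: "finite P" and ne: "P \<noteq> {}" using assms(3,5) by auto
  have le: "emeasure lborel S \<le> emeasure lborel (ball_hull r P)"
    using assms by (intro emeasure_spindle_le_ball_hull[OF _ fin ne]) auto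
  obtain c where "P \<subseteq> cball c r0"
    using least_enclosing_ball(2)[OF finite_imp_bounded[OF fin] ne] assms(6) by auto
  then have "P \<subseteq> cball c r" using assms(1) by force
  then have finite: "emeasure lborel (ball_hull r P) < \<infinity>" by (rule emeasure_ball_hull_finite)
  obtain K where "S = ball_hull r K"
    using assms(7) unfolding is_spindle_of_circumradius_def is_spindle_def by blast
  then have "S \<in> sets borel" by simp
  then have "measure lborel S \<le> measure lborel (ball_hull r P)"
    unfolding measure_def using le finite by (intro enn2real_mono) auto
  then show ?thesis
    using \<open>S \<in> sets borel\<close> by (simp add: measure_completion)
qed

end
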